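(* Let $X$ be a set, and let $S$ be either the symmetric inverse semigroup $\mathcal I_X$ (for any $X$), or the dual symmetric inverse semigroup $\mathcal I_X^*$ with $|X|\ge3$. Then $$\operatorname{Aut}(S)\cong\operatorname{Sym}(X)\qquad\text{and}\qquad \mathscr C(S)=\operatorname{Aut}^{\pm}(S)\cong\mathbb Z_2\times\operatorname{Sym}(X).$$
   Context: $\mathcal I_X$ is the monoid of all bijections between subsets of $X$ (partial injective maps of $X$) under composition of partial maps. $\mathcal I_X^*$ is the monoid of all bijections $\theta:X/\alpha\to X/\beta$ between quotients of $X$ ($\alpha,\beta$ equivalence relations on $X$); equivalently, identifying $\theta$ with the relation $\{(x,y)\in X\times X: \theta([x]_\alpha)=[y]_\beta\}$, it consists of all block bijections of $X$, where the product of two block bijections $\theta,\phi$ is the smallest block bijection containing the relational composite of $\theta$ and $\phi$. $\operatorname{Sym}(X)$ is the group of all permutations of $X$. For a semigroup $S$: $\operatorname{Aut}(S)$ is the set of automorphisms of $S$; $\operatorname{Aut}^-(S)$ is the set of anti-automorphisms, i.e. bijections $\alpha:S\to S$ with $\alpha(xy)=\alpha(y)\alpha(x)$ for all $x,y\in S$; $\operatorname{Aut}^{\pm}(S)=\operatorname{Aut}(S)\cup\operatorname{Aut}^-(S)$, a group under composition. $I(S)=\{\alpha\in\operatorname{Aut}^-(S):\alpha^2=\mathrm{id}_S\neq\alpha\}$ is the set of involutions of $S$, and $\mathscr C(S)=\langle I(S)\rangle\le\operatorname{Aut}^{\pm}(S)$, interpreted as $\{\mathrm{id}_S\}$ if 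$I(S)=\emptyset$.
   Formalization: The isomorphism of Aut^±(I_X) with Z_2 × Sym(X) is stated only for |X| ≥ 2, because for |X| ≤ 1 the group Aut^±(I_X) is trivial while Z_2 × Sym(X) has order 2; all other claims are kept in full. *)

theory Defs
  imports
    "HOL-Algebra.Bij"
    "HOL-Algebra.Generated_Groups"
    "HOL-Algebra.Elementary_Groups"
begin

section \<open>Automorphisms, anti-automorphisms and involutions\<close>

text \<open>
  A semigroup is given by the carrier and multiplication of a monoid record.  As in
  \<^theory>\<open>HOL-Algebra.Bij\<close>, self-maps of a carrier are extensional functions, so that
  \<^const>\<open>auto\<close>, \<^const>\<open>AutoGroup\<close> and \<^const>\<open>BijGroup\<close> (for the symmetric group) apply.
\<close>

definition anti_auto :: "('b, 'm) monoid_scheme \<Rightarrow> ('b \<Rightarrow> 'b) set" where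
  "anti_auto S = {f \<in> Bij (carrier S).
     \<forall>x\<in>carrier S. \<forall>y\<in>carrier S. f (x \<otimes>\<^bsub>S\<^esub> y) = f y \<otimes>\<^bsub>S\<^esub> f x}"

definition AutPMGroup :: "('b, 'm) monoid_scheme \<Rightarrow> ('b \<Rightarrow> 'b) monoid" where
  "AutPMGroup S = BijGroup (carrier S) \<lparr>carrier := auto S \<union> anti_auto S\<rparr>"

definition involutions :: "('b, 'm) monoid_scheme \<Rightarrow> ('b \<Rightarrow> 'b) set" where
  "involutions S = {f \<in> anti_auto S.
     compose (carrier S) f f = (\<lambda>x\<in>carrier S. x) \<and> f \<noteq> (\<lambda>x\<in>carrier S. x)}"

text \<open>The library's \<^const>\<open>generate\<close> yields just the identity for an empty generating set.\<close>

definition involution_span :: "('b, 'm) monoid_scheme \<Rightarrow> ('b \<Rightarrow> 'b) set" where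
  "involution_span S = generate (AutPMGroup S) (involutions S)"


section \<open>The symmetric inverse monoid\<close>

text \<open>Here \<open>f \<circ>\<^sub>m g\<close> applies \<open>g\<close> first, whereas the relational composite below applies the left
  factor first.  The two orders give anti-isomorphic monoids with the same automorphisms and
  anti-automorphisms.\<close>

definition sym_inv_monoid :: "'a set \<Rightarrow> ('a \<rightharpoonup> 'a) monoid" where
  "sym_inv_monoid X =
    \<lparr>carrier = {f. dom f \<subseteq> X \<and> ran f \<subseteq> X \<and> inj_on f (dom f)},
     mult = (\<circ>\<^sub>m),
     one = Some |` X\<rparr>"


section \<open>The dual symmetric inverse monoid\<close>

definition block_bijections :: "'a set \<Rightarrow> ('a \<times> 'a) set set" where
  "block_bijections X =
    {R. \<exists>\<alpha> \<beta> \<theta>. equiv X \<alpha> \<and> equiv X \<beta> \<and> bij_betw \<theta> (X // \<alpha>) (X // \<beta>) \<and>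
        R = {(x, y). x \<in> X \<and> y \<in> X \<and> \<theta> (\<alpha> `` {x}) = \<beta> `` {y}}}"

definition dual_sym_inv_monoid :: "'a set \<Rightarrow> ('a \<times> 'a) set monoid" where
  "dual_sym_inv_monoid X =
    \<lparr>carrier = block_bijections X,
     mult = (\<lambda>R T. LEAST U. U \<in> block_bijections X \<and> R O T \<subseteq> U),
     one = Id_on X\<rparr>"


section \<open>Well-definedness\<close>

lemma monoid_sym_inv_monoid: "monoid (sym_inv_monoid X)"
proof (rule monoidI, goal_cases)
  case (1 f g)
  have "inj_on (f \<circ>\<^sub>m g) (dom (f \<circ>\<^sub>m g))"
  proof (rule inj_onI)
    fix x y assume "x \<in> dom (f \<circ>\<^sub>m g)" "y \<in> dom (f \<circ>\<^sub>m g)" and e: "(f \<circ>\<^sub>m g) x = (f \<circ>\<^sub>m g) y"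
    then obtain u v w where u: "g x = Some u" "f u = Some w" and v: "g y = Some v" "f v = Some w"
      by (auto simp: map_comp_def split: option.splits)
    have "u = v" using 1(1) u(2) v(2) inj_onD[of f "dom f" u v] by (auto simp: sym_inv_monoid_def)
    then show "x = y" using 1(2) u(1) v(1) \<open>u = v\<close> inj_onD[of g "dom g" x y] by (auto simp: sym_inv_monoid_def)
  qed
  moreover have "dom (f \<circ>\<^sub>m g) \<subseteq> dom g" "ran (f \<circ>\<^sub>m g) \<subseteq> ran f"
    by (auto simp: map_comp_def ran_def split: option.splits)
  moreover have "dom g \<subseteq> X" "ran f \<subseteq> X" using 1 by (simp_all add: sym_inv_monoid_def)
  ultimately have "dom (f \<circ>\<^sub>m g) \<subseteq> X \<and> ran (f \<circ>\<^sub>m g) \<subseteq> X \<and> inj_on (f \<circ>\<^sub>m g) (dom (f \<circ>\<^sub>m g))"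
    by (meson order_trans)
  then show ?case by (simp add: sym_inv_monoid_def)
next
  case 2
  show ?case
    by (auto simp: sym_inv_monoid_def restrict_map_def ran_def inj_on_def split: if_splits)
next
  case (3 f g h)
  show ?case by (auto simp: sym_inv_monoid_def map_comp_def fun_eq_iff split: option.split)
next
  case (4 f)
  then have "ran f \<subseteq> X" by (simp add: sym_inv_monoid_def)
  then have "(Some |` X \<circ>\<^sub>m f) x = f x" for x
    by (cases "f x") (auto simp: map_comp_def restrict_map_def ran_def)
  then show ?case by (simp add: sym_inv_monoid_def fun_eq_iff)
next
  case (5 f)
  then have "dom f \<subseteq> X" by (simp add: sym_inv_monoid_def)
  then have "f x = None" if "x \<notin> X" for x using that by (auto simp: domIff)
  then have "(f \<circ>\<^sub>m Some |` X) x = f x" for x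
    by (cases "x \<in> X") (simp_all add: map_comp_def)
  then show ?case by (simp add: sym_inv_monoid_def fun_eq_iff)
qed

text \<open>Block bijections are the full difunctional relations; hence they are closed under
  intersection as long as the intersection is full, and the product exists.\<close>

lemma block_bijections_iff:
  "R \<in> block_bijections X \<longleftrightarrow>
     R \<subseteq> X \<times> X \<and> X \<subseteq> Domain R \<and> X \<subseteq> Range R \<and> R O R\<inverse> O R \<subseteq> R"
proof
  assume "R \<in> block_bijections X"
  then obtain \<alpha> \<beta> \<theta> where a: "equiv X \<alpha>" and b: "equiv X \<beta>"
    and t: "bij_betw \<theta> (X // \<alpha>) (X // \<beta>)"
    and R: "R = {(x, y). x \<in> X \<and> y \<in> X \<and> \<theta> (\<alpha> `` {x}) = \<beta> `` {y}}"
    unfolding block_bijections_def by blast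
  have "x \<in> Domain R" if "x \<in> X" for x
  proof -
    have "\<theta> (\<alpha> `` {x}) \<in> X // \<beta>" using that t by (meson bij_betwE quotientI)
    then show ?thesis using that R by (auto elim!: quotientE)
  qed
  moreover have "y \<in> Range R" if "y \<in> X" for y
  proof -
    have "\<beta> `` {y} \<in> \<theta> ` (X // \<alpha>)" using that t by (metis bij_betw_imp_surj_on quotientI)
    then obtain x where "x \<in> X" "\<beta> `` {y} = \<theta> (\<alpha> `` {x})" by (auto elim!: quotientE)
    then show ?thesis using that R by auto
  qed
  ultimately show "R \<subseteq> X \<times> X \<and> X \<subseteq> Domain R \<and> X \<subseteq> Range R \<and> R O R\<inverse> O R \<subseteq> R"
    using R by auto
next
  assume H: "R \<subseteq> X \<times> X \<and> X \<subseteq> Domain R \<and> X \<subseteq> Range R \<and> R O R\<inverse> O R \<subseteq> R"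
  then have D: "(x, w) \<in> R" if "(x, y) \<in> R" "(z, y) \<in> R" "(z, w) \<in> R" for x y z w
    using that by blast
  let ?\<alpha> = "R O R\<inverse>" and ?\<beta> = "R\<inverse> O R"
  have a: "equiv X ?\<alpha>" and b: "equiv X ?\<beta>"
    using H by (auto intro!: equivI refl_onI symI transI dest: D)
  have im: "R `` (?\<alpha> `` {x}) = ?\<beta> `` {y}" if "(x, y) \<in> R" for x y
    using that by (auto dest: D)
  have bij: "bij_betw (\<lambda>A. R `` A) (X // ?\<alpha>) (X // ?\<beta>)"
  proof (rule bij_betwI[where g = "\<lambda>B. R\<inverse> `` B"])
    show "(\<lambda>A. R `` A) \<in> X // ?\<alpha> \<rightarrow> X // ?\<beta>"
    proof
      fix A assume "A \<in> X // ?\<alpha>"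
      then obtain x where x: "x \<in> X" "A = ?\<alpha> `` {x}" by (auto elim!: quotientE)
      then obtain y where "(x, y) \<in> R" "y \<in> X" using H by blast
      with im x show "R `` A \<in> X // ?\<beta>" by (auto intro: quotientI)
    qed
    have im': "R\<inverse> `` (?\<beta> `` {y}) = ?\<alpha> `` {x}" if "(x, y) \<in> R" for x y
      using that by (auto dest: D)
    show "(\<lambda>B. R\<inverse> `` B) \<in> X // ?\<beta> \<rightarrow> X // ?\<alpha>"
    proof
      fix B assume "B \<in> X // ?\<beta>"
      then obtain y where y: "y \<in> X" "B = ?\<beta> `` {y}" by (auto elim!: quotientE)
      then obtain x where "(x, y) \<in> R" "x \<in> X" using H by blast
      with im' y show "R\<inverse> `` B \<in> X // ?\<alpha>" by (metis quotientI)
    qed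
    show "R\<inverse> `` (R `` A) = A" if A: "A \<in> X // ?\<alpha>" for A
    proof -
      obtain x where x: "x \<in> X" "A = ?\<alpha> `` {x}" using A by (auto elim!: quotientE)
      then obtain y where "(x, y) \<in> R" using H by blast
      with im im' x show ?thesis by metis
    qed
    show "R `` (R\<inverse> `` B) = B" if B: "B \<in> X // ?\<beta>" for B
    proof -
      obtain y where y: "y \<in> X" "B = ?\<beta> `` {y}" using B by (auto elim!: quotientE)
      then obtain x where "(x, y) \<in> R" using H by blast
      with im im' y show ?thesis by metis
    qed
  qed
  have "R = {(x, y). x \<in> X \<and> y \<in> X \<and> R `` (?\<alpha> `` {x}) = ?\<beta> `` {y}}" (is "_ = ?R")
  proof (rule Set.set_eqI)
    fix p :: "'a \<times> 'a"
    obtain x y where p: "p = (x, y)" by (cases p)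
    have "(x, y) \<in> R" if xy: "x \<in> X" "y \<in> X" "R `` (?\<alpha> `` {x}) = ?\<beta> `` {y}"
    proof -
      obtain y' where y': "(x, y') \<in> R" using H xy(1) by blast
      then have "?\<beta> `` {y'} = ?\<beta> `` {y}" using im xy(3) by metis
      moreover have "y \<in> ?\<beta> `` {y}" using b xy(2) by (meson equiv_class_self)
      ultimately have "(y', y) \<in> ?\<beta>" by blast
      then show ?thesis using y' by (auto intro: D)
    qed
    moreover have "x \<in> X \<and> y \<in> X \<and> R `` (?\<alpha> `` {x}) = ?\<beta> `` {y}" if "(x, y) \<in> R"
      using that im[OF that] H by blast
    ultimately show "p \<in> R \<longleftrightarrow> p \<in> ?R" unfolding p by blast
  qed
  with a b bij show "R \<in> block_bijections X"
    unfolding block_bijections_def by blast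
qed

lemma dual_sym_inv_mult:
  assumes R: "R \<in> block_bijections X" and T: "T \<in> block_bijections X"
  shows "R \<otimes>\<^bsub>dual_sym_inv_monoid X\<^esub> T = \<Inter> {U \<in> block_bijections X. R O T \<subseteq> U}"
    and "R \<otimes>\<^bsub>dual_sym_inv_monoid X\<^esub> T \<in> block_bijections X"
    and "R O T \<subseteq> R \<otimes>\<^bsub>dual_sym_inv_monoid X\<^esub> T"
proof -
  let ?F = "{U \<in> block_bijections X. R O T \<subseteq> U}"
  have RT: "R O T \<subseteq> X \<times> X" "X \<subseteq> Domain (R O T)" "X \<subseteq> Range (R O T)"
  proof -
    have r: "R \<subseteq> X \<times> X" "X \<subseteq> Domain R" "X \<subseteq> Range R"
      and t: "T \<subseteq> X \<times> X" "X \<subseteq> Domain T" "X \<subseteq> Range T"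
      using R T by (simp_all add: block_bijections_iff)
    show "R O T \<subseteq> X \<times> X" using r(1) t(1) by blast
    show "X \<subseteq> Domain (R O T)"
    proof
      fix x assume "x \<in> X"
      then obtain y where y: "(x, y) \<in> R" using r(2) by blast
      then obtain z where "(y, z) \<in> T" using r(1) t(2) by blast
      with y show "x \<in> Domain (R O T)" by blast
    qed
    show "X \<subseteq> Range (R O T)"
    proof
      fix z assume "z \<in> X"
      then obtain y where y: "(y, z) \<in> T" using t(3) by blast
      then obtain x where "(x, y) \<in> R" using t(1) r(3) by blast
      with y show "z \<in> Range (R O T)" by blast
    qed
  qed
  have "X \<times> X \<in> ?F" using RT(1) by (auto simp: block_bijections_iff)
  then have top: "\<Inter> ?F \<subseteq> X \<times> X" by (rule Inter_lower)
  have sub: "R O T \<subseteq> \<Inter> ?F" by blast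
  have di: "\<Inter> ?F O (\<Inter> ?F)\<inverse> O \<Inter> ?F \<subseteq> \<Inter> ?F"
  proof -
    have "\<Inter> ?F O (\<Inter> ?F)\<inverse> O \<Inter> ?F \<subseteq> U" if U: "U \<in> ?F" for U
    proof -
      have "\<Inter> ?F \<subseteq> U" using U by blast
      then have "\<Inter> ?F O (\<Inter> ?F)\<inverse> O \<Inter> ?F \<subseteq> U O U\<inverse> O U"
        by (intro relcomp_mono) (auto simp only: converse_mono)
      moreover have "U O U\<inverse> O U \<subseteq> U" using U by (simp add: block_bijections_iff)
      ultimately show ?thesis by (rule order_trans)
    qed
    then show ?thesis by (rule Inter_greatest)
  qed
  have full: "X \<subseteq> Domain (\<Inter> ?F)" "X \<subseteq> Range (\<Inter> ?F)"
    using RT(2,3) Domain_mono[OF sub] Range_mono[OF sub] by (meson order_trans)+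
  have mem: "\<Inter> ?F \<in> block_bijections X"
    unfolding block_bijections_iff[of "\<Inter> ?F"] using top full di by (intro conjI)
  show eq: "R \<otimes>\<^bsub>dual_sym_inv_monoid X\<^esub> T = \<Inter> ?F"
    unfolding dual_sym_inv_monoid_def monoid.simps
    by (rule Least_equality) (use mem sub in \<open>blast intro: Inter_lower\<close>)+
  show "R \<otimes>\<^bsub>dual_sym_inv_monoid X\<^esub> T \<in> block_bijections X" "R O T \<subseteq> R \<otimes>\<^bsub>dual_sym_inv_monoid X\<^esub> T"
    unfolding eq by (rule mem, rule sub)
qed

lemma group_AutPMGroup:
  assumes cl: "\<And>x y. x \<in> carrier S \<Longrightarrow> y \<in> carrier S \<Longrightarrow> x \<otimes>\<^bsub>S\<^esub> y \<in> carrier S"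
  shows "group (AutPMGroup S)"
proof -
  let ?C = "carrier S" and ?A = "auto S \<union> anti_auto S"
  have mem: "f x \<in> ?C" if "f \<in> Bij ?C" "x \<in> ?C" for f x
    using that by (auto simp: Bij_def bij_betw_def)
  have A: "f \<in> ?A \<longleftrightarrow> f \<in> Bij ?C \<and>
      ((\<forall>x\<in>?C. \<forall>y\<in>?C. f (x \<otimes>\<^bsub>S\<^esub> y) = f x \<otimes>\<^bsub>S\<^esub> f y) \<or> (\<forall>x\<in>?C. \<forall>y\<in>?C. f (x \<otimes>\<^bsub>S\<^esub> y) = f y \<otimes>\<^bsub>S\<^esub> f x))" for f
    by (auto simp: auto_def anti_auto_def hom_def intro: mem)
  have "subgroup ?A (BijGroup ?C)"
  proof (rule group.subgroupI[OF group_BijGroup])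
    show "?A \<subseteq> carrier (BijGroup ?C)" using A by (auto simp: BijGroup_def auto_def anti_auto_def)
    have "(\<lambda>x\<in>?C. x) \<in> ?A" unfolding A using cl by (auto simp: id_Bij)
    then show "?A \<noteq> {}" by blast
    show "f \<otimes>\<^bsub>BijGroup ?C\<^esub> g \<in> ?A" if "f \<in> ?A" "g \<in> ?A" for f g
      using that cl mem unfolding A by (auto simp: BijGroup_def compose_Bij compose_eq)
    show "inv\<^bsub>BijGroup ?C\<^esub> f \<in> ?A" if f: "f \<in> ?A" for f
    proof -
      have B: "f \<in> Bij ?C" using f A by blast
      let ?g = "inv_into ?C f"
      have g: "?g x \<in> ?C" "f (?g x) = x" if "x \<in> ?C" for x
        using B that by (auto simp: Bij_def bij_betw_def inv_into_into f_inv_into_f)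
      have gf: "?g z = w" if "w \<in> ?C" "f w = z" for w z
        using B that by (auto simp: Bij_def bij_betw_def)
      have "(\<forall>x\<in>?C. \<forall>y\<in>?C. ?g (x \<otimes>\<^bsub>S\<^esub> y) = ?g x \<otimes>\<^bsub>S\<^esub> ?g y) \<or>
            (\<forall>x\<in>?C. \<forall>y\<in>?C. ?g (x \<otimes>\<^bsub>S\<^esub> y) = ?g y \<otimes>\<^bsub>S\<^esub> ?g x)"
        using f unfolding A by (elim conjE disjE) (rule disjI1 disjI2, simp add: gf g cl)+
      then show ?thesis unfolding A inv_BijGroup[OF B]
        using B by (simp add: restrict_inv_into_Bij cl)
    qed
  qed
  then show ?thesis
    unfolding AutPMGroup_def by (rule subgroup.subgroup_is_group[OF _ group_BijGroup])
qed

text \<open>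
  On a set with at most one point the symmetric inverse monoid has no automorphism or
  anti-automorphism besides the identity, so the description of its group of automorphisms and
  anti-automorphisms as a direct product with a group of order two needs two distinct points.
\<close>

lemma AutPMGroup_sym_inv_monoid_degenerate:
  assumes X: "X \<subseteq> {a}"
  shows "\<not> AutPMGroup (sym_inv_monoid X) \<cong> integer_mod_group 2 \<times>\<times> BijGroup X"
proof
  let ?S = "sym_inv_monoid X" and ?C = "carrier (sym_inv_monoid X)"
  assume iso: "AutPMGroup ?S \<cong> integer_mod_group 2 \<times>\<times> BijGroup X"
  have zero: "Map.empty \<in> ?C" by (simp add: sym_inv_monoid_def)
  have C: "?C \<subseteq> {Map.empty, Some |` X}"
  proof
    fix f assume f: "f \<in> ?C"
    have "f = Some |` X" if "f \<noteq> Map.empty"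
    proof -
      obtain x y where xy: "f x = Some y" using \<open>f \<noteq> Map.empty\<close> by (metis not_None_eq)
      then have "x \<in> X" "y \<in> X" using f by (auto simp: sym_inv_monoid_def dom_def ran_def)
      then have "X = {a}" "x = a" "y = a" using X by auto
      moreover have "f z = None" if "z \<noteq> a" for z
        using f that \<open>X = {a}\<close> by (auto simp: sym_inv_monoid_def dom_def)
      ultimately show ?thesis using xy by (auto simp: restrict_map_def)
    qed
    then show "f \<in> {Map.empty, Some |` X}" by blast
  qed
  have "f = (\<lambda>x\<in>?C. x)" if f: "f \<in> auto ?S \<union> anti_auto ?S" for f
  proof -
    have B: "f \<in> Bij ?C" using f by (auto simp: auto_def anti_auto_def)
    then have bij: "bij_betw f ?C ?C" and ext: "f \<in> extensional ?C" by (auto simp: Bij_def)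
    have hom: "f (x \<otimes>\<^bsub>?S\<^esub> y) = f x \<otimes>\<^bsub>?S\<^esub> f y \<or> f (x \<otimes>\<^bsub>?S\<^esub> y) = f y \<otimes>\<^bsub>?S\<^esub> f x"
      if "x \<in> ?C" "y \<in> ?C" for x y
      using f that by (auto simp: auto_def anti_auto_def hom_def)
    have z: "f Map.empty = Map.empty"
    proof -
      obtain w where w: "w \<in> ?C" "f w = Map.empty"
      proof -
        have "Map.empty \<in> f ` ?C" using bij zero by (simp add: bij_betw_def)
        then show ?thesis using that by force
      qed
      have e: "Map.empty \<otimes>\<^bsub>?S\<^esub> v = Map.empty" "v \<otimes>\<^bsub>?S\<^esub> Map.empty = Map.empty" for v
        by (simp_all add: sym_inv_monoid_def)
      show ?thesis using hom[OF zero w(1)] unfolding w(2) e by simp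
    qed
    have "f x = x" if x: "x \<in> ?C" for x
    proof (cases "x = Map.empty")
      case False
      have "f x \<noteq> Map.empty" using False z bij x zero by (metis bij_betw_def inj_onD)
      moreover have "f x \<in> ?C" using bij x by (auto simp: bij_betw_def)
      ultimately show ?thesis using C x False by blast
    qed (use z in simp)
    then show ?thesis using ext by (auto simp: extensional_def fun_eq_iff)
  qed
  then have "carrier (AutPMGroup ?S) \<subseteq> {\<lambda>x\<in>?C. x}" by (auto simp: AutPMGroup_def)
  then have "card (carrier (AutPMGroup ?S)) \<le> 1"
    by (metis card_mono card.empty card_insert_disjoint One_nat_def empty_iff finite.intros)
  moreover have "Bij X = {\<lambda>x\<in>X. x}"
  proof -
    have "f = (\<lambda>x\<in>X. x)" if "f \<in> Bij X" for f
    proof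
      fix z
      show "f z = (\<lambda>x\<in>X. x) z"
      proof (cases "z \<in> X")
        case True
        then have "f z \<in> X" using that by (auto simp: Bij_def bij_betw_def)
        with True X show ?thesis by auto
      qed (use that in \<open>auto simp: Bij_def extensional_def\<close>)
    qed
    then show ?thesis using id_Bij by auto
  qed
  then have "card (carrier (integer_mod_group 2 \<times>\<times> BijGroup X)) = 2"
    by (simp add: carrier_integer_mod_group BijGroup_def card_cartesian_product)
  ultimately show False using iso_same_card[OF iso] by simp
qed

end

(* An automorphism permutes any class of elements that is definable in the semigroup.  In I_X the
   primitive idempotents are the partial identities 1_x on single points, and a partial map f sends x to
   y iff 1_y f 1_x is not zero, so an automorphism is conjugation by the permutation it induces on points.
   In the dual monoid the minimal non-identity idempotents ("atoms") identify one pair of points, and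
   three pairs form a triangle iff the atom of the third is absorbed by the product of the other two;
   hence an automorphism induces a permutation of pairs that preserves triangles, which comes from a
   permutation of X.  After conjugating back, all atoms are fixed, and products with atoms show that
   such an automorphism fixes every block bijection.  Inversion is an anti-automorphism commuting with
   all automorphisms, and every permutation is a product of two involutions. *)

theory Submission
  imports Defs
begin

text \<open>Products with atoms reveal only the two partitions of a block bijection, not how their
  blocks are matched. The matching is recovered from a coincidence: merging two source blocks by an
  atom on the left gives the same element as merging the two corresponding target blocks by an atom
  on the right, so unordered pairs of blocks are matched correctly. With at least three blocks this
  determines the matching; with two blocks a swap remains possible, and excluding it takes three
  points. On two points the dual monoid is a group of order two with a zero adjoined, whose only
  automorphism is the identity. Triangles, and not just meeting pairs, lead from pairs to points: on
  four points, exchanging {1,4} with {2,3} and fixing the other four pairs preserves meeting, but no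
  permutation of points induces it. Noncommutativity keeps inversion out of the automorphism group
  and so splits off the factor of order two.\<close>

section \<open>Groups generated by an index-two factor and a central involution\<close>

text \<open>The image of \<open>K\<close> and the subgroup {1, t} commute elementwise, meet
  trivially and together exhaust \<open>G\<close>, so \<open>G\<close> is their internal direct
  product, via (i, k) -> \<phi>(k) t^i.\<close>

lemma (in group) iso_Z2_times:
  assumes K: "group K" and \<phi>: "\<phi> \<in> hom K G" and inj: "inj_on \<phi> (carrier K)"
    and t: "t \<in> carrier G" "t \<otimes> t = \<one>" "t \<notin> \<phi> ` carrier K"
    and comm: "\<And>k. k \<in> carrier K \<Longrightarrow> \<phi> k \<otimes> t = t \<otimes> \<phi> k"
    and cover: "carrier G = \<phi> ` carrier K \<union> (\<lambda>k. \<phi> k \<otimes> t) ` carrier K"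
  shows "G \<cong> integer_mod_group 2 \<times>\<times> K"
proof -
  interpret K: group K by (rule K)
  let ?Z = "integer_mod_group 2"
  have Zc: "carrier ?Z = {0, 1}" by (auto simp: carrier_integer_mod_group)
  have Zm: "i \<otimes>\<^bsub>?Z\<^esub> j = (i + j) mod 2" for i j by (simp add: integer_mod_group_def)
  have \<phi>_closed [simp]: "\<phi> k \<in> carrier G" if "k \<in> carrier K" for k
    using \<phi> that by (auto simp: hom_def)
  have \<phi>_mult: "\<phi> (k \<otimes>\<^bsub>K\<^esub> l) = \<phi> k \<otimes> \<phi> l" if "k \<in> carrier K" "l \<in> carrier K" for k l
    using \<phi> that by (auto simp: hom_def)
  let ?\<psi> = "\<lambda>(i :: int, k). if i = 0 then \<phi> k else \<phi> k \<otimes> t"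
  have tt: "\<phi> k \<otimes> t \<otimes> (\<phi> l \<otimes> t) = \<phi> k \<otimes> \<phi> l" if "k \<in> carrier K" "l \<in> carrier K" for k l
  proof -
    have "\<phi> k \<otimes> t \<otimes> (\<phi> l \<otimes> t) = \<phi> k \<otimes> (t \<otimes> (t \<otimes> \<phi> l))"
      using that t(1) comm[of l] by (simp add: m_assoc)
    also have "\<dots> = \<phi> k \<otimes> \<phi> l" using that t by (simp add: m_assoc[symmetric])
    finally show ?thesis .
  qed
  have swap: "\<phi> k \<otimes> t \<otimes> \<phi> l = \<phi> k \<otimes> \<phi> l \<otimes> t" if "k \<in> carrier K" "l \<in> carrier K" for k l
    using that t(1) comm[of l] by (simp add: m_assoc)
  have right: "\<phi> k \<otimes> (\<phi> l \<otimes> t) = \<phi> k \<otimes> \<phi> l \<otimes> t" if "k \<in> carrier K" "l \<in> carrier K" for k l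
    using that t(1) by (simp add: m_assoc)
  have "?\<psi> \<in> hom (?Z \<times>\<times> K) G"
    by (rule homI) (auto simp: Zc Zm t \<phi>_mult tt swap right)
  moreover have "bij_betw ?\<psi> (carrier (?Z \<times>\<times> K)) (carrier G)"
    unfolding bij_betw_def
  proof
    have ne: "\<phi> k \<noteq> \<phi> l \<otimes> t" if "k \<in> carrier K" "l \<in> carrier K" for k l
    proof
      assume "\<phi> k = \<phi> l \<otimes> t"
      then have "t = inv (\<phi> l) \<otimes> \<phi> k" using that t(1) by (simp add: m_assoc[symmetric])
      also have "\<dots> = \<phi> (inv\<^bsub>K\<^esub> l \<otimes>\<^bsub>K\<^esub> k)"
      proof -
        interpret group_hom K G \<phi> by unfold_locales (rule \<phi>)
        show ?thesis using that by (simp add: \<phi>_mult)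
      qed
      finally show False using t(3) that by auto
    qed
    show "inj_on ?\<psi> (carrier (?Z \<times>\<times> K))"
      using inj t(1) ne ne[symmetric] by (auto simp: Zc inj_on_def)
    show "?\<psi> ` carrier (?Z \<times>\<times> K) = carrier G"
      unfolding cover by (auto simp: Zc image_iff)
  qed
  ultimately have "?Z \<times>\<times> K \<cong> G" unfolding is_iso_def iso_def by blast
  moreover have "group (?Z \<times>\<times> K)" by (intro DirProd_group) (simp_all add: K)
  ultimately show ?thesis using group.iso_sym by blast
qed


section \<open>Every permutation is a product of two involutions\<close>

lemma carrier_BijGroup [simp]: "carrier (BijGroup X) = Bij X"
  by (simp add: BijGroup_def)

lemma one_BijGroup: "\<one>\<^bsub>BijGroup X\<^esub> = (\<lambda>x\<in>X. x)"
  by (simp add: BijGroup_def)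

lemma mult_BijGroup: "f \<in> Bij X \<Longrightarrow> g \<in> Bij X \<Longrightarrow> f \<otimes>\<^bsub>BijGroup X\<^esub> g = compose X f g"
  by (simp add: BijGroup_def)

lemma Bij_mem: "f \<in> Bij X \<Longrightarrow> x \<in> X \<Longrightarrow> f x \<in> X"
  by (auto simp: Bij_def bij_betw_def)

lemma Bij_eq_iff: "f \<in> Bij X \<Longrightarrow> x \<in> X \<Longrightarrow> y \<in> X \<Longrightarrow> f x = f y \<longleftrightarrow> x = y"
  by (auto simp: Bij_def bij_betw_def inj_on_def)

lemma Bij_surj: "f \<in> Bij X \<Longrightarrow> y \<in> X \<Longrightarrow> \<exists>x\<in>X. y = f x"
  by (auto simp: Bij_def bij_betw_def)

lemma Bij_ext: "f \<in> Bij X \<Longrightarrow> g \<in> Bij X \<Longrightarrow> (\<And>x. x \<in> X \<Longrightarrow> f x = g x) \<Longrightarrow> f = g"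
  by (auto simp: Bij_def intro: extensionalityI)

lemma Bij_inverse:
  assumes p: "p \<in> Bij X"
  obtains q where "q \<in> Bij X" "compose X p q = (\<lambda>x\<in>X. x)" "compose X q p = (\<lambda>x\<in>X. x)"
proof -
  interpret G: group "BijGroup X" by (rule group_BijGroup)
  have i: "inv\<^bsub>BijGroup X\<^esub> p \<in> Bij X" using G.inv_closed[of p] p by simp
  show thesis
    using that[OF i] G.r_inv[of p] G.l_inv[of p] p i by (simp add: mult_BijGroup one_BijGroup)
qed

text \<open>On each orbit of \<open>p\<close>, with chosen base point \<open>r\<close>, the reflection \<open>p\<^sup>k r \<mapsto> p\<^sup>-\<^sup>k r\<close> is an
  involution that inverts \<open>p\<close>.\<close>

lemma Bij_product_of_two_involutions:
  assumes p: "p \<in> Bij X"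
  obtains s u where "s \<in> Bij X" "u \<in> Bij X" "p = compose X s u"
    "compose X s s = (\<lambda>x\<in>X. x)" "compose X u u = (\<lambda>x\<in>X. x)"
proof -
  interpret G: group "BijGroup X" by (rule group_BijGroup)
  define e where "e k = p [^]\<^bsub>BijGroup X\<^esub> (k::int)" for k
  have eB: "e k \<in> Bij X" for k
    using G.int_pow_closed[of p k] p by (simp add: e_def)
  have e_mem: "e k x \<in> X" if "x \<in> X" for k x using Bij_mem[OF eB that] .
  have e_add: "e (i + j) x = e i (e j x)" if "x \<in> X" for i j x
  proof -
    have "e (i + j) = compose X (e i) (e j)"
      using G.int_pow_mult[of p i j] p eB mult_BijGroup[OF eB eB] by (simp add: e_def)
    then show ?thesis using that by (simp add: compose_def)
  qed
  have e0: "e 0 x = x" if "x \<in> X" for x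
    using that by (simp add: e_def one_BijGroup)
  have e1: "e 1 x = p x" for x
    using p by (simp add: e_def)
  \<comment> \<open>The predicate describes the orbit of \<open>x\<close>, so the chosen point
    depends on the orbit only.\<close>
  define r where "r x = (SOME y. \<exists>k. y = e k x)" for x
  have rex: "\<exists>k. r x = e k x" for x unfolding r_def by (rule someI_ex) blast
  have r_mem: "r x \<in> X" if "x \<in> X" for x using rex[of x] that e_mem by auto
  have r_inv: "r (e j x) = r x" if "x \<in> X" for j x
  proof -
    have "(\<exists>k. y = e k (e j x)) \<longleftrightarrow> (\<exists>k. y = e k x)" for y
    proof
      assume "\<exists>k. y = e k x"
      then obtain k where "y = e k x" by blast
      then have "y = e (k - j) (e j x)" using e_add[OF that, of "k - j" j] by simp
      then show "\<exists>k. y = e k (e j x)" by blast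
    qed (use e_add[OF that] in metis)
    then show ?thesis unfolding r_def by simp
  qed
  have orb: "\<exists>k. x = e k (r x)" if "x \<in> X" for x
  proof -
    obtain k where "r x = e k x" using rex by blast
    then have "e (-k) (r x) = x" using e_add[OF that, of "-k" k] e0[OF that] by simp
    then show ?thesis by metis
  qed
  \<comment> \<open>On a finite orbit the exponent is not unique. The value does not depend on it:
    if \<open>e k\<close> and \<open>e j\<close> agree at the base point, then so do
    \<open>e (-k)\<close> and \<open>e (-j)\<close>.\<close>
  define \<tau> where "\<tau> = (\<lambda>x\<in>X. e (- (SOME k. x = e k (r x))) (r x))"
  have \<tau>_e: "\<tau> (e j (r x)) = e (-j) (r x)" if x: "x \<in> X" for j x
  proof -
    obtain m where m: "r x = e m x" using rex by blast
    let ?y = "e j (r x)"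
    have ry: "r ?y = r x"
      using x r_inv[OF x] r_inv[OF r_mem[OF x]] m by simp
    have y: "?y \<in> X" by (rule e_mem[OF r_mem[OF x]])
    define k where "k = (SOME k. ?y = e k (r ?y))"
    have k: "?y = e k (r x)" using someI_ex[OF orb[OF y]] unfolding k_def ry .
    have "e (-k) (r x) = e (-j-k) ?y" using e_add[OF r_mem[OF x], of "-j-k" j] by simp
    also have "\<dots> = e (-j) (r x)"
      using e_add[OF r_mem[OF x], of "-j-k" k] k by simp
    finally have "e (-k) (r x) = e (-j) (r x)" .
    moreover have "\<tau> ?y = e (- (SOME k. ?y = e k (r ?y))) (r ?y)"
      unfolding \<tau>_def using y by (rule restrict_apply')
    then have "\<tau> ?y = e (-k) (r x)" by (simp only: k_def ry)
    ultimately show ?thesis by simp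
  qed
  have \<tau>_mem: "\<tau> x \<in> X" if "x \<in> X" for x
    using that e_mem r_mem by (simp add: \<tau>_def)
  have \<tau>\<tau>: "\<tau> (\<tau> x) = x" if x: "x \<in> X" for x
  proof -
    obtain k where k: "x = e k (r x)" using orb[OF x] by blast
    have "\<tau> x = e (-k) (r x)" using \<tau>_e[OF x, of k] k by simp
    then show ?thesis using \<tau>_e[OF x, of "-k"] k by simp
  qed
  \<comment> \<open>The dihedral relation \<tau> p \<tau> = p^-1, in the form that makes \<tau> p an
    involution.\<close>
  have \<tau>p: "\<tau> (p (\<tau> (p x))) = x" if x: "x \<in> X" for x
  proof -
    obtain k where k: "x = e k (r x)" using orb[OF x] by blast
    have pe: "p (e i (r x)) = e (1 + i) (r x)" for i
      using e_add[OF r_mem[OF x], of 1 i] e1 by simp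
    have "\<tau> (p (\<tau> (p (e k (r x))))) = e k (r x)" by (simp add: pe \<tau>_e[OF x])
    then show ?thesis using k by simp
  qed
  have \<tau>B: "\<tau> \<in> Bij X"
    unfolding Bij_def using \<tau>_mem \<tau>\<tau>
    by (auto intro!: bij_betwI[where g = \<tau>] simp: \<tau>_def)
  show thesis
  proof
    show "\<tau> \<in> Bij X" "compose X \<tau> p \<in> Bij X" using \<tau>B p by (auto intro: compose_Bij)
    show "p = compose X \<tau> (compose X \<tau> p)"
      by (rule Bij_ext[OF p]) (use \<tau>B p \<tau>\<tau> in \<open>auto intro: compose_Bij simp: compose_eq Bij_mem\<close>)
    show "compose X \<tau> \<tau> = (\<lambda>x\<in>X. x)"
      by (rule Bij_ext[OF _ id_Bij]) (use \<tau>B \<tau>\<tau> in \<open>auto intro: compose_Bij simp: compose_eq\<close>)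
    show "compose X (compose X \<tau> p) (compose X \<tau> p) = (\<lambda>x\<in>X. x)"
      by (rule Bij_ext[OF _ id_Bij])
        (use \<tau>B p \<tau>p in \<open>auto intro!: compose_Bij simp: compose_eq Bij_mem\<close>)
  qed
qed


section \<open>Semigroups whose automorphisms are the permutations of a set\<close>

text \<open>The common interface of both monoids: a faithful action of Sym(X) by automorphisms that
  exhausts them, and an anti-automorphic inversion of order at most two commuting with the action.
  Noncommutativity is left to the individual theorems, because \<I>_X on at most one point fits the
  interface and is commutative.\<close>

locale sym_semigroup =
  fixes S :: "('b, 'm) monoid_scheme" and X :: "'a set"
    and \<Phi> :: "('a \<Rightarrow> 'a) \<Rightarrow> 'b \<Rightarrow> 'b" and iv :: "'b \<Rightarrow> 'b"
  assumes mult_closed: "s \<in> carrier S \<Longrightarrow> u \<in> carrier S \<Longrightarrow> s \<otimes>\<^bsub>S\<^esub> u \<in> carrier S"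
    and \<Phi>_closed: "p \<in> Bij X \<Longrightarrow> s \<in> carrier S \<Longrightarrow> \<Phi> p s \<in> carrier S"
    and \<Phi>_mult: "p \<in> Bij X \<Longrightarrow> s \<in> carrier S \<Longrightarrow> u \<in> carrier S \<Longrightarrow> \<Phi> p (s \<otimes>\<^bsub>S\<^esub> u) = \<Phi> p s \<otimes>\<^bsub>S\<^esub> \<Phi> p u"
    and \<Phi>_id: "s \<in> carrier S \<Longrightarrow> \<Phi> (\<lambda>x\<in>X. x) s = s"
    and \<Phi>_compose: "p \<in> Bij X \<Longrightarrow> q \<in> Bij X \<Longrightarrow> s \<in> carrier S \<Longrightarrow> \<Phi> (compose X p q) s = \<Phi> p (\<Phi> q s)"
    and \<Phi>_faithful: "p \<in> Bij X \<Longrightarrow> q \<in> Bij X \<Longrightarrow> (\<And>s. s \<in> carrier S \<Longrightarrow> \<Phi> p s = \<Phi> q s) \<Longrightarrow> p = q"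
    and \<Phi>_full: "F \<in> auto S \<Longrightarrow> \<exists>p\<in>Bij X. \<forall>s\<in>carrier S. F s = \<Phi> p s"
    and iv_closed: "s \<in> carrier S \<Longrightarrow> iv s \<in> carrier S"
    and iv_iv: "s \<in> carrier S \<Longrightarrow> iv (iv s) = s"
    and iv_mult: "s \<in> carrier S \<Longrightarrow> u \<in> carrier S \<Longrightarrow> iv (s \<otimes>\<^bsub>S\<^esub> u) = iv u \<otimes>\<^bsub>S\<^esub> iv s"
    and \<Phi>_iv: "p \<in> Bij X \<Longrightarrow> s \<in> carrier S \<Longrightarrow> \<Phi> p (iv s) = iv (\<Phi> p s)"
begin

abbreviation (input) C :: "'b set" where "C \<equiv> carrier S"
abbreviation (input) \<phi> :: "('a \<Rightarrow> 'a) \<Rightarrow> 'b \<Rightarrow> 'b" where "\<phi> p \<equiv> restrict (\<Phi> p) C"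
abbreviation (input) t :: "'b \<Rightarrow> 'b" where "t \<equiv> restrict iv C"
abbreviation (input) A :: "('b \<Rightarrow> 'b) monoid" where "A \<equiv> AutPMGroup S"

section \<open>The automorphism group as the image of the symmetric group\<close>

lemma \<Phi>_Bij: assumes p: "p \<in> Bij X" shows "\<phi> p \<in> Bij C"
proof -
  obtain q where q: "q \<in> Bij X" "compose X p q = (\<lambda>x\<in>X. x)" "compose X q p = (\<lambda>x\<in>X. x)"
    using Bij_inverse[OF p] by metis
  have "\<Phi> p (\<Phi> q s) = s" "\<Phi> q (\<Phi> p s) = s" if "s \<in> C" for s
    using \<Phi>_compose[OF p q(1) that] \<Phi>_compose[OF q(1) p that] q(2,3) \<Phi>_id[OF that] by simp_all
  then have "bij_betw (\<phi> p) C C"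
    by (intro bij_betwI[where g = "\<Phi> q"]) (auto simp: p q \<Phi>_closed)
  then show ?thesis by (simp add: Bij_def)
qed

lemma t_Bij: "t \<in> Bij C"
  unfolding Bij_def by (auto intro!: bij_betwI[where g = iv] simp: iv_closed iv_iv)

lemma \<phi>_auto: "p \<in> Bij X \<Longrightarrow> \<phi> p \<in> auto S"
  by (auto simp: auto_def \<Phi>_Bij hom_def \<Phi>_closed \<Phi>_mult mult_closed)

lemma auto_eq: "auto S = \<phi> ` Bij X"
proof
  show "auto S \<subseteq> \<phi> ` Bij X"
  proof
    fix F assume F: "F \<in> auto S"
    then obtain p where p: "p \<in> Bij X" "\<forall>s\<in>C. F s = \<Phi> p s" using \<Phi>_full by blast
    then have "F = \<phi> p"
      using F by (intro Bij_ext[OF _ \<Phi>_Bij]) (auto simp: auto_def)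
    then show "F \<in> \<phi> ` Bij X" using p by blast
  qed
qed (use \<phi>_auto in blast)

lemma \<phi>_compose: "p \<in> Bij X \<Longrightarrow> q \<in> Bij X \<Longrightarrow> \<phi> (compose X p q) = compose C (\<phi> p) (\<phi> q)"
  by (rule Bij_ext[of _ C]) (auto simp: \<Phi>_Bij compose_Bij compose_eq \<Phi>_compose \<Phi>_closed)

lemma \<phi>_inj: "inj_on \<phi> (Bij X)"
proof (rule inj_onI)
  fix p q assume pq: "p \<in> Bij X" "q \<in> Bij X" "\<phi> p = \<phi> q"
  have "\<Phi> p s = \<Phi> q s" if "s \<in> C" for s using fun_cong[OF pq(3), of s] that by simp
  then show "p = q" using \<Phi>_faithful pq by blast
qed

theorem AutoGroup_iso: "AutoGroup S \<cong> BijGroup X"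
proof -
  have "\<phi> \<in> iso (BijGroup X) (AutoGroup S)"
    unfolding iso_def
    by (auto simp: hom_def AutoGroup_def \<phi>_auto mult_BijGroup \<phi>_compose \<Phi>_Bij bij_betw_def \<phi>_inj auto_eq)
  then have "BijGroup X \<cong> AutoGroup S" by (auto simp: is_iso_def)
  then show ?thesis using group.iso_sym[OF group_BijGroup] by blast
qed

section \<open>Anti-automorphisms and the group generated by the involutions\<close>

lemma t_anti: "t \<in> anti_auto S"
  by (auto simp: anti_auto_def t_Bij iv_closed iv_mult mult_closed)

lemma tt: "compose C t t = (\<lambda>x\<in>C. x)"
  by (rule Bij_ext[OF _ id_Bij]) (auto simp: compose_Bij t_Bij compose_eq iv_iv iv_closed)

lemma \<phi>_t: "p \<in> Bij X \<Longrightarrow> compose C (\<phi> p) t = compose C t (\<phi> p)"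
  by (rule Bij_ext[of _ C]) (auto simp: compose_Bij \<Phi>_Bij t_Bij compose_eq iv_closed \<Phi>_closed \<Phi>_iv)

lemma \<phi>_t_anti: "p \<in> Bij X \<Longrightarrow> compose C (\<phi> p) t \<in> anti_auto S"
  using compose_Bij[OF \<Phi>_Bij t_Bij]
  by (auto simp: anti_auto_def compose_eq iv_closed iv_mult mult_closed \<Phi>_mult)

text \<open>Composing with \<open>t\<close> exchanges automorphisms and anti-automorphisms, so the
  latter form the coset of \<open>t\<close>.\<close>

lemma anti_auto_eq: "anti_auto S = (\<lambda>p. compose C (\<phi> p) t) ` Bij X"
proof
  show "anti_auto S \<subseteq> (\<lambda>p. compose C (\<phi> p) t) ` Bij X"
  proof
    fix F assume F: "F \<in> anti_auto S"
    then have FB: "F \<in> Bij C" by (simp add: anti_auto_def)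
    have "compose C F t \<in> auto S"
      using F compose_Bij[OF FB t_Bij]
      by (auto simp: auto_def hom_def anti_auto_def compose_eq iv_closed iv_mult mult_closed Bij_mem)
    then obtain p where p: "p \<in> Bij X" "compose C F t = \<phi> p" using auto_eq by auto
    have "F = compose C (\<phi> p) t"
      unfolding p(2)[symmetric]
      by (rule Bij_ext[OF FB]) (auto simp: compose_Bij FB t_Bij compose_eq iv_closed iv_iv)
    then show "F \<in> (\<lambda>p. compose C (\<phi> p) t) ` Bij X" using p(1) by blast
  qed
qed (use \<phi>_t_anti in blast)

lemma group_A: "group A"
  by (rule group_AutPMGroup) (rule mult_closed)

lemma carrier_A: "carrier A = auto S \<union> anti_auto S"
  and mult_A: "F \<in> Bij C \<Longrightarrow> H \<in> Bij C \<Longrightarrow> F \<otimes>\<^bsub>A\<^esub> H = compose C F H"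
  and one_A: "\<one>\<^bsub>A\<^esub> = (\<lambda>x\<in>C. x)"
  by (simp_all add: AutPMGroup_def BijGroup_def)

text \<open>If inversion both preserves and reverses products, any two of its values commute, and
  every element is such a value.\<close>

lemma t_in_auto_iff: "t \<in> auto S \<longleftrightarrow> (\<forall>s\<in>C. \<forall>u\<in>C. s \<otimes>\<^bsub>S\<^esub> u = u \<otimes>\<^bsub>S\<^esub> s)"
proof
  assume "t \<in> auto S"
  then have "iv (s \<otimes>\<^bsub>S\<^esub> u) = iv s \<otimes>\<^bsub>S\<^esub> iv u" if "s \<in> C" "u \<in> C" for s u
    using that by (auto simp: auto_def hom_def mult_closed)
  then show "\<forall>s\<in>C. \<forall>u\<in>C. s \<otimes>\<^bsub>S\<^esub> u = u \<otimes>\<^bsub>S\<^esub> s"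
    by (metis iv_mult iv_iv iv_closed)
qed (auto simp: auto_def t_Bij hom_def iv_closed mult_closed iv_mult)

theorem AutPMGroup_iso:
  assumes "s \<in> C" "u \<in> C" "s \<otimes>\<^bsub>S\<^esub> u \<noteq> u \<otimes>\<^bsub>S\<^esub> s"
  shows "A \<cong> integer_mod_group 2 \<times>\<times> BijGroup X"
proof (rule group.iso_Z2_times[OF group_A group_BijGroup, where \<phi> = \<phi> and t = t])
  show "\<phi> \<in> hom (BijGroup X) A"
    by (auto simp: hom_def carrier_A \<phi>_auto mult_BijGroup \<phi>_compose mult_A \<Phi>_Bij)
  show "t \<notin> \<phi> ` carrier (BijGroup X)"
    using t_in_auto_iff assms by (auto simp: auto_eq[symmetric])
  show "carrier A = \<phi> ` carrier (BijGroup X) \<union> (\<lambda>p. \<phi> p \<otimes>\<^bsub>A\<^esub> t) ` carrier (BijGroup X)"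
    by (auto simp: carrier_A auto_eq anti_auto_eq mult_A \<Phi>_Bij t_Bij)
qed (auto simp: \<phi>_inj carrier_A t_anti mult_A t_Bij tt one_A \<Phi>_Bij \<phi>_t)

text \<open>Whenever p has square 1, \<phi>(p) t is an involution. Since t is central of order two,
  (\<phi>(q) t)(\<phi>(r) t) = \<phi>(qr), and every permutation is such a product qr; one more
  factor t reaches the anti-automorphisms.\<close>

theorem involution_span_eq:
  assumes "s \<in> C" "u \<in> C" "s \<otimes>\<^bsub>S\<^esub> u \<noteq> u \<otimes>\<^bsub>S\<^esub> s"
  shows "involution_span S = carrier A"
proof
  interpret A: group A by (rule group_A)
  have inv_sub: "involutions S \<subseteq> carrier A"
    by (auto simp: involutions_def carrier_A)
  then show "involution_span S \<subseteq> carrier A"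
    unfolding involution_span_def by (rule A.generate_incl)
  \<comment> \<open>Here p may be the identity. The composite with \<open>t\<close> is still not the
    identity map, which would be an anti-automorphism only for commutative \<open>S\<close>.\<close>
  have \<phi>t_mem: "compose C (\<phi> p) t \<in> involutions S"
    if p: "p \<in> Bij X" "compose X p p = (\<lambda>x\<in>X. x)" for p
  proof -
    have \<Phi>pp: "\<Phi> p (\<Phi> p x) = x" if "x \<in> C" for x
      using \<Phi>_compose[OF p(1) p(1) that] p(2) \<Phi>_id[OF that] by simp
    have "compose C (compose C (\<phi> p) t) (compose C (\<phi> p) t) = (\<lambda>x\<in>C. x)"
      by (rule Bij_ext[OF _ id_Bij])
        (auto simp: p compose_Bij t_Bij \<Phi>_Bij compose_eq \<Phi>_closed iv_closed \<Phi>_iv iv_iv \<Phi>pp)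
    moreover have "compose C (\<phi> p) t \<noteq> (\<lambda>x\<in>C. x)"
    proof
      assume "compose C (\<phi> p) t = (\<lambda>x\<in>C. x)"
      then have "(\<lambda>x\<in>C. x) \<in> anti_auto S" using \<phi>_t_anti[OF p(1)] by simp
      then show False using assms by (auto simp: anti_auto_def mult_closed)
    qed
    ultimately show ?thesis using \<phi>_t_anti[OF p(1)] by (simp add: involutions_def)
  qed
  have t_mem: "t \<in> involutions S"
  proof -
    have "compose C (\<phi> (\<lambda>x\<in>X. x)) t = t"
      by (rule Bij_ext[OF _ t_Bij])
        (auto simp: compose_Bij t_Bij \<Phi>_Bij id_Bij compose_eq iv_closed \<Phi>_id)
    then show ?thesis
      using \<phi>t_mem[OF id_Bij] Bij_ext[OF compose_Bij[OF id_Bij id_Bij] id_Bij]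
      by (auto simp: compose_eq)
  qed
  have \<phi>_mem: "\<phi> p \<in> involution_span S" if p: "p \<in> Bij X" for p
  proof -
    obtain q r where q: "q \<in> Bij X" "compose X q q = (\<lambda>x\<in>X. x)"
      and r: "r \<in> Bij X" "compose X r r = (\<lambda>x\<in>X. x)" and pqr: "p = compose X q r"
      using Bij_product_of_two_involutions[OF p] by metis
    have "\<phi> p = compose C (compose C (\<phi> q) t) (compose C (\<phi> r) t)"
      by (rule Bij_ext[of _ C])
        (auto simp: pqr q r compose_Bij t_Bij \<Phi>_Bij compose_eq \<Phi>_closed iv_closed \<Phi>_iv iv_iv \<Phi>_compose)
    also have "\<dots> = compose C (\<phi> q) t \<otimes>\<^bsub>A\<^esub> compose C (\<phi> r) t"
      using q r by (simp add: mult_A compose_Bij \<Phi>_Bij t_Bij)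
    finally show ?thesis
      unfolding involution_span_def
      using generate.eng[OF generate.incl[OF \<phi>t_mem[OF q]] generate.incl[OF \<phi>t_mem[OF r]], of A]
      by simp
  qed
  have "compose C (\<phi> p) t \<in> involution_span S" if p: "p \<in> Bij X" for p
    using generate.eng[OF \<phi>_mem[OF p, unfolded involution_span_def] generate.incl[OF t_mem]]
    unfolding involution_span_def by (simp add: mult_A \<Phi>_Bij t_Bij p)
  with \<phi>_mem show "carrier A \<subseteq> involution_span S"
    by (auto simp: carrier_A auto_eq anti_auto_eq)
qed

end


section \<open>The symmetric inverse monoid\<close>

text \<open>Meaningful only for single-valued \<open>P\<close>; otherwise an arbitrary value is chosen.\<close>

definition map_of_rel :: "('a \<Rightarrow> 'b \<Rightarrow> bool) \<Rightarrow> 'a \<rightharpoonup> 'b" where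
  "map_of_rel P = (\<lambda>x. if \<exists>y. P x y then Some (SOME y. P x y) else None)"

lemma map_of_rel_eq_Some:
  assumes "\<And>x y z. P x y \<Longrightarrow> P x z \<Longrightarrow> y = z"
  shows "map_of_rel P x = Some y \<longleftrightarrow> P x y"
  unfolding map_of_rel_def by (auto intro: someI2 assms)

lemma map_Some_eqI: "(\<And>x y. f x = Some y \<longleftrightarrow> g x = Some y) \<Longrightarrow> f = g"
  by (rule ext) (metis not_None_eq)

definition map_converse :: "('a \<rightharpoonup> 'b) \<Rightarrow> 'b \<rightharpoonup> 'a" where
  "map_converse f = map_of_rel (\<lambda>y x. f x = Some y)"

text \<open>The conjugate p f p^-1, described through its graph so that no inverse of
  \<open>p\<close> has to be written.\<close>

definition map_conj :: "'a set \<Rightarrow> ('a \<Rightarrow> 'a) \<Rightarrow> ('a \<rightharpoonup> 'a) \<Rightarrow> 'a \<rightharpoonup> 'a" where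
  "map_conj X p f = map_of_rel (\<lambda>u v. \<exists>x\<in>X. \<exists>y\<in>X. u = p x \<and> v = p y \<and> f x = Some y)"

abbreviation IX :: "'a set \<Rightarrow> ('a \<rightharpoonup> 'a) set" where
  "IX X \<equiv> carrier (sym_inv_monoid X)"

lemma IX_iff:
  "f \<in> IX X \<longleftrightarrow> (\<forall>x y. f x = Some y \<longrightarrow> x \<in> X \<and> y \<in> X) \<and>
     (\<forall>x x' y. f x = Some y \<longrightarrow> f x' = Some y \<longrightarrow> x = x')"
  unfolding sym_inv_monoid_def by (auto simp: ran_def inj_on_def dom_def subset_iff)

lemma mult_IX [simp]: "f \<otimes>\<^bsub>sym_inv_monoid X\<^esub> g = f \<circ>\<^sub>m g"
  by (simp add: sym_inv_monoid_def)

lemma mult_closed_IX: "f \<in> IX X \<Longrightarrow> g \<in> IX X \<Longrightarrow> f \<circ>\<^sub>m g \<in> IX X"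
  using monoid.m_closed[OF monoid_sym_inv_monoid] by fastforce

lemma map_converse_Some: "f \<in> IX X \<Longrightarrow> map_converse f y = Some x \<longleftrightarrow> f x = Some y"
  unfolding map_converse_def by (subst map_of_rel_eq_Some) (auto simp: IX_iff)

lemma map_conj_Some:
  "f \<in> IX X \<Longrightarrow> p \<in> Bij X \<Longrightarrow>
    map_conj X p f u = Some v \<longleftrightarrow> (\<exists>x\<in>X. \<exists>y\<in>X. u = p x \<and> v = p y \<and> f x = Some y)"
  unfolding map_conj_def by (subst map_of_rel_eq_Some) (auto simp: Bij_eq_iff)

lemma map_converse_IX: "f \<in> IX X \<Longrightarrow> map_converse f \<in> IX X"
  unfolding IX_iff[of "map_converse f"] by (auto simp: map_converse_Some) (auto simp: IX_iff)

lemma map_conj_IX: "f \<in> IX X \<Longrightarrow> p \<in> Bij X \<Longrightarrow> map_conj X p f \<in> IX X"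
  unfolding IX_iff[of "map_conj X p f"]
  by (auto simp: map_conj_Some Bij_eq_iff Bij_mem) (auto simp: IX_iff)

lemma map_conj_comp:
  assumes "p \<in> Bij X" "f \<in> IX X" "g \<in> IX X"
  shows "map_conj X p (f \<circ>\<^sub>m g) = map_conj X p f \<circ>\<^sub>m map_conj X p g"
proof (rule map_Some_eqI)
  fix u v
  have "map_conj X p (f \<circ>\<^sub>m g) u = Some v \<longleftrightarrow>
      (\<exists>x\<in>X. \<exists>y\<in>X. \<exists>z\<in>X. u = p x \<and> v = p z \<and> g x = Some y \<and> f y = Some z)"
    using assms IX_iff[of f X]
    by (simp add: map_conj_Some mult_closed_IX map_comp_Some_iff) fast
  also have "\<dots> \<longleftrightarrow> (map_conj X p f \<circ>\<^sub>m map_conj X p g) u = Some v"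
    using assms by (auto simp: map_conj_Some map_comp_Some_iff Bij_eq_iff)
  finally show "map_conj X p (f \<circ>\<^sub>m g) u = Some v \<longleftrightarrow>
    (map_conj X p f \<circ>\<^sub>m map_conj X p g) u = Some v" .
qed

section \<open>Primitive idempotents and automorphisms of the symmetric inverse monoid\<close>

abbreviation point :: "'a \<Rightarrow> 'a \<rightharpoonup> 'a" where "point x \<equiv> [x \<mapsto> x]"

lemma point_IX: "x \<in> X \<Longrightarrow> point x \<in> IX X"
  by (auto simp: IX_iff split: if_splits)

lemma empty_IX: "Map.empty \<in> IX X"
  by (auto simp: IX_iff)

lemma point_comp: "(point y \<circ>\<^sub>m (f \<circ>\<^sub>m point x)) \<noteq> Map.empty \<longleftrightarrow> f x = Some y"
  by (auto simp: fun_eq_iff map_comp_def split: option.splits if_splits)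

lemma point_eq_iff: "point x = point y \<longleftrightarrow> x = y"
  by (metis fun_upd_same fun_upd_other option.distinct(1))

text \<open>Between idempotents, \<open>e \<circ>\<^sub>m f = f\<close> means f <= e. Only products
  and the zero occur, so automorphisms visibly preserve the property.\<close>

definition primitive_idem :: "'a set \<Rightarrow> ('a \<rightharpoonup> 'a) \<Rightarrow> bool" where
  "primitive_idem X e \<longleftrightarrow> e \<in> IX X \<and> e \<noteq> Map.empty \<and> e \<circ>\<^sub>m e = e \<and>
     (\<forall>f\<in>IX X. f \<circ>\<^sub>m f = f \<and> e \<circ>\<^sub>m f = f \<longrightarrow> f = Map.empty \<or> f = e)"

text \<open>From f x = y idempotency gives f y = y, and injectivity identifies x with y; idempotents
  are thus partial identities.\<close>

lemma idem_IX: assumes "f \<in> IX X" "f \<circ>\<^sub>m f = f" "f x = Some y" shows "x = y"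
proof -
  have "(f \<circ>\<^sub>m f) x = Some y" using assms by simp
  then have "f y = Some y" using assms(3) by (auto simp: map_comp_Some_iff)
  then show ?thesis using assms(1,3) by (auto simp: IX_iff)
qed

text \<open>A nonempty idempotent fixes some x in its domain and hence lies above
  \<open>point x\<close>, while strictly below \<open>point x\<close> there is only the empty
  map.\<close>

lemma primitive_idem_iff: "primitive_idem X e \<longleftrightarrow> (\<exists>x\<in>X. e = point x)"
proof
  assume e: "primitive_idem X e"
  then obtain x y where xy: "e x = Some y" unfolding primitive_idem_def by (metis not_None_eq)
  then have ex: "e x = Some x" and x: "x \<in> X"
    using e idem_IX[of e X x y] by (auto simp: primitive_idem_def IX_iff)
  have "e \<circ>\<^sub>m point x = point x" "point x \<circ>\<^sub>m point x = point x"
    using ex by (auto simp: fun_eq_iff map_comp_def split: option.splits if_splits)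
  then have "point x = e" using e point_IX[OF x] unfolding primitive_idem_def by fastforce
  then show "\<exists>x\<in>X. e = point x" using x by blast
next
  assume "\<exists>x\<in>X. e = point x"
  then obtain x where x: "x \<in> X" "e = point x" by blast
  have "f = Map.empty \<or> f = point x" if f: "f \<in> IX X" "f \<circ>\<^sub>m f = f" "point x \<circ>\<^sub>m f = f" for f
  proof -
    have *: "y = x \<and> z = x" if "f y = Some z" for y z
    proof -
      have "(point x \<circ>\<^sub>m f) y = Some z" using f(3) that by simp
      then have "z = x" by (auto simp: map_comp_Some_iff split: if_splits)
      then show ?thesis using idem_IX[OF f(1,2) that] by simp
    qed
    show ?thesis
    proof (cases "f x")
      case None
      then have "f y = None" for y using * by (cases "f y") auto
      then show ?thesis by blast
    next
      case (Some z)
      then have "f x = Some x" using * by blast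
      moreover have "f y = None" if "y \<noteq> x" for y using * that by (cases "f y") auto
      ultimately show ?thesis by (auto simp: fun_eq_iff)
    qed
  qed
  then show "primitive_idem X e"
    unfolding primitive_idem_def x(2) using point_IX[OF x(1)] by auto
qed

lemma sym_inv_full:
  assumes F: "F \<in> auto (sym_inv_monoid X)"
  shows "\<exists>p\<in>Bij X. \<forall>f\<in>IX X. F f = map_conj X p f"
proof -
  have FB: "F \<in> Bij (IX X)" using F by (simp add: auto_def)
  have hom: "F (f \<circ>\<^sub>m g) = F f \<circ>\<^sub>m F g" if "f \<in> IX X" "g \<in> IX X" for f g
    using F that by (auto simp: auto_def hom_def)
  have mem: "F f \<in> IX X" if "f \<in> IX X" for f using Bij_mem[OF FB that] .
  have eq: "F f = F g \<longleftrightarrow> f = g" if "f \<in> IX X" "g \<in> IX X" for f g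
    using Bij_eq_iff[OF FB that] .
  have F0: "F Map.empty = Map.empty"
  proof -
    \<comment> \<open>A preimage \<open>w\<close> of zero turns absorption before applying
      \<open>F\<close> into absorption after it: F 0 = F (0 w) = (F 0) 0 = 0.\<close>
    obtain w where w: "w \<in> IX X" "Map.empty = F w" using Bij_surj[OF FB empty_IX] by blast
    have "F (Map.empty \<circ>\<^sub>m w) = F Map.empty \<circ>\<^sub>m F w" by (rule hom[OF empty_IX w(1)])
    then show ?thesis using w(2)[symmetric] by simp
  qed
  have F0_iff: "F f = Map.empty \<longleftrightarrow> f = Map.empty" if "f \<in> IX X" for f
    using eq[OF that empty_IX] F0 by simp
  have prim: "primitive_idem X (F e) \<longleftrightarrow> primitive_idem X e" if e: "e \<in> IX X" for e
  proof -
    have surj: "F ` IX X = IX X" using FB by (simp add: Bij_def bij_betw_def)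
    have "(\<forall>f\<in>IX X. f \<circ>\<^sub>m f = f \<and> F e \<circ>\<^sub>m f = f \<longrightarrow> f = Map.empty \<or> f = F e) \<longleftrightarrow>
        (\<forall>f\<in>IX X. F f \<circ>\<^sub>m F f = F f \<and> F e \<circ>\<^sub>m F f = F f \<longrightarrow> F f = Map.empty \<or> F f = F e)"
      by (subst (1) surj[symmetric]) blast
    also have "\<dots> \<longleftrightarrow> (\<forall>f\<in>IX X. f \<circ>\<^sub>m f = f \<and> e \<circ>\<^sub>m f = f \<longrightarrow> f = Map.empty \<or> f = e)"
      using e by (intro ball_cong) (simp_all add: hom[symmetric] eq F0_iff mult_closed_IX)
    finally show ?thesis
      unfolding primitive_idem_def
      using e by (simp add: mem hom[symmetric] eq F0_iff mult_closed_IX)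
  qed
  have "\<forall>x\<in>X. \<exists>y\<in>X. F (point x) = point y"
    using prim[OF point_IX] by (auto simp: primitive_idem_iff)
  then obtain q where q: "\<And>x. x \<in> X \<Longrightarrow> q x \<in> X \<and> F (point x) = point (q x)" by metis
  define p where "p = restrict q X"
  have p: "p x \<in> X" "F (point x) = point (p x)" if "x \<in> X" for x using q that by (auto simp: p_def)
  have pB: "p \<in> Bij X"
    unfolding Bij_def bij_betw_def
  proof (intro IntI CollectI conjI)
    show "p \<in> extensional X" by (simp add: p_def)
    show "inj_on p X"
    proof (rule inj_onI)
      fix x y assume "x \<in> X" "y \<in> X" "p x = p y"
      then show "x = y" using eq[OF point_IX point_IX, of x y] p(2) point_eq_iff[of x y] by simp
    qed
    show "p ` X = X"
    proof
      show "X \<subseteq> p ` X"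
      proof
        fix y assume y: "y \<in> X"
        obtain e where e: "e \<in> IX X" "point y = F e" using Bij_surj[OF FB point_IX[OF y]] by blast
        have "primitive_idem X (point y)" using y by (auto simp: primitive_idem_iff)
        then have "primitive_idem X e" using prim[OF e(1)] e(2) by simp
        then obtain x where x: "x \<in> X" "e = point x" by (auto simp: primitive_idem_iff)
        then have "y = p x" using e(2) p(2) point_eq_iff[of y "p x"] by simp
        then show "y \<in> p ` X" using x(1) by blast
      qed
    qed (use p in blast)
  qed
  have "F f = map_conj X p f" if f: "f \<in> IX X" for f
  proof (rule map_Some_eqI)
    fix u v
    have *: "F f (p x) = Some (p y) \<longleftrightarrow> f x = Some y" if xy: "x \<in> X" "y \<in> X" for x y
    proof -
      have "F f (p x) = Some (p y) \<longleftrightarrow> F (point y \<circ>\<^sub>m (f \<circ>\<^sub>m point x)) \<noteq> Map.empty"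
        using f xy by (simp add: hom mult_closed_IX point_IX p point_comp)
      also have "\<dots> \<longleftrightarrow> f x = Some y"
        using eq[of _ Map.empty] f xy F0 by (simp add: mult_closed_IX point_IX empty_IX point_comp)
      finally show ?thesis .
    qed
    have "F f u = Some v \<longleftrightarrow> (\<exists>x\<in>X. \<exists>y\<in>X. u = p x \<and> v = p y \<and> F f u = Some v)"
      using mem[OF f] Bij_surj[OF pB, of u] Bij_surj[OF pB, of v] unfolding IX_iff[of "F f"] by blast
    then show "F f u = Some v \<longleftrightarrow> map_conj X p f u = Some v"
      unfolding map_conj_Some[OF f pB] using * by blast
  qed
  then show ?thesis using pB by blast
qed

section \<open>Conjugation and inversion on the symmetric inverse monoid\<close>

interpretation sym_inv: sym_semigroup "sym_inv_monoid X" X "map_conj X" map_converse for X :: "'a set"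
proof
  fix p q :: "'a \<Rightarrow> 'a" and f g :: "'a \<rightharpoonup> 'a"
  show "f \<otimes>\<^bsub>sym_inv_monoid X\<^esub> g \<in> IX X" if "f \<in> IX X" "g \<in> IX X"
    using that by (simp add: mult_closed_IX)
  show "map_conj X p (f \<otimes>\<^bsub>sym_inv_monoid X\<^esub> g) =
      map_conj X p f \<otimes>\<^bsub>sym_inv_monoid X\<^esub> map_conj X p g"
    if "p \<in> Bij X" "f \<in> IX X" "g \<in> IX X"
    using that by (simp add: map_conj_comp)
  show "map_conj X (\<lambda>x\<in>X. x) f = f" if "f \<in> IX X"
    by (rule map_Some_eqI) (use that in \<open>auto simp: map_conj_Some id_Bij\<close>, auto simp: IX_iff)
  show "map_conj X (compose X p q) f = map_conj X p (map_conj X q f)"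
    if pq: "p \<in> Bij X" "q \<in> Bij X" and f: "f \<in> IX X"
  proof (rule map_Some_eqI)
    fix u v
    show "map_conj X (compose X p q) f u = Some v \<longleftrightarrow> map_conj X p (map_conj X q f) u = Some v"
      using pq f
      by (auto simp: map_conj_Some compose_Bij map_conj_IX compose_eq) (blast intro: Bij_mem)
  qed
  show "p = q" if pq: "p \<in> Bij X" "q \<in> Bij X"
    and all: "\<And>s. s \<in> IX X \<Longrightarrow> map_conj X p s = map_conj X q s"
  proof (rule Bij_ext[OF pq])
    fix x assume x: "x \<in> X"
    have "map_conj X p (point x) (p x) = Some (p x)"
      using pq x by (auto simp: map_conj_Some point_IX)
    then have "map_conj X q (point x) (p x) = Some (p x)" using all[OF point_IX[OF x]] by simp
    then show "p x = q x" using pq x by (auto simp: map_conj_Some point_IX split: if_splits)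
  qed
  show "map_converse (map_converse f) = f" if "f \<in> IX X"
    by (rule map_Some_eqI) (use that in \<open>auto simp: map_converse_Some[of _ X] map_converse_IX\<close>)
  show "map_converse (f \<otimes>\<^bsub>sym_inv_monoid X\<^esub> g) =
      map_converse g \<otimes>\<^bsub>sym_inv_monoid X\<^esub> map_converse f"
    if "f \<in> IX X" "g \<in> IX X"
    by (rule map_Some_eqI)
      (use that in \<open>auto simp: map_converse_Some[of _ X] map_converse_IX mult_closed_IX map_comp_Some_iff\<close>)
  show "map_conj X p (map_converse f) = map_converse (map_conj X p f)"
    if "p \<in> Bij X" "f \<in> IX X"
    by (rule map_Some_eqI)
      (use that in \<open>auto simp: map_converse_Some[of _ X] map_converse_IX map_conj_IX map_conj_Some\<close>)
qed (simp_all add: map_conj_IX map_converse_IX sym_inv_full)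

text \<open>The map sending only x to y is unchanged when preceded by the identity on {x}, but
  becomes undefined at x when followed by it.\<close>

lemma sym_inv_noncomm:
  assumes "x \<in> X" "y \<in> X" "x \<noteq> y"
  shows "\<exists>s\<in>IX X. \<exists>u\<in>IX X. s \<otimes>\<^bsub>sym_inv_monoid X\<^esub> u \<noteq> u \<otimes>\<^bsub>sym_inv_monoid X\<^esub> s"
proof -
  have "[x \<mapsto> y] \<in> IX X" using assms by (auto simp: IX_iff split: if_splits)
  moreover have "([x \<mapsto> y] \<circ>\<^sub>m point x) x \<noteq> (point x \<circ>\<^sub>m [x \<mapsto> y]) x" using assms by simp
  ultimately show ?thesis using point_IX[OF assms(1)] by (metis mult_IX)
qed

text \<open>On at most one point inversion is trivial, there are no involutions, and the only
  (anti-)automorphism is the identity.\<close>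

lemma sym_inv_span:
  "involution_span (sym_inv_monoid X) = carrier (AutPMGroup (sym_inv_monoid X))"
proof (cases "\<exists>x\<in>X. \<exists>y\<in>X. x \<noteq> y")
  case True
  then show ?thesis using sym_inv_noncomm sym_inv.involution_span_eq by metis
next
  case False
  let ?A = "AutPMGroup (sym_inv_monoid X)" and ?i = "\<lambda>f\<in>IX X. f"
  have BX: "Bij X = {\<lambda>x\<in>X. x}"
  proof -
    have "f = (\<lambda>x\<in>X. x)" if f: "f \<in> Bij X" for f
      by (rule Bij_ext[OF f id_Bij]) (use False Bij_mem[OF f] in auto)
    then show ?thesis using id_Bij by blast
  qed
  have "map_converse f = f" if f: "f \<in> IX X" for f
  proof (rule map_Some_eqI)
    fix x y show "map_converse f x = Some y \<longleftrightarrow> f x = Some y"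
      using f False unfolding map_converse_Some[OF f] by (metis IX_iff)
  qed
  then have "restrict map_converse (IX X) = ?i" by (auto simp: fun_eq_iff)
  moreover have "restrict (map_conj X (\<lambda>x\<in>X. x)) (IX X) = ?i"
    by (auto simp: fun_eq_iff sym_inv.\<Phi>_id)
  moreover have "compose (IX X) ?i ?i = ?i" by (simp add: id_Bij Bij_imp_extensional)
  ultimately have cA: "carrier ?A = {?i}"
    by (auto simp: sym_inv.carrier_A sym_inv.auto_eq sym_inv.anti_auto_eq BX)
  then have "involutions (sym_inv_monoid X) = {}"
    by (auto simp: sym_inv.carrier_A involutions_def)
  then show ?thesis
    using group.generate_empty[OF sym_inv.group_A[of X]] cA
    by (simp add: involution_span_def sym_inv.one_A)
qed


section \<open>Permutations of the pairs of a set\<close>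

definition pairs :: "'a set \<Rightarrow> 'a set set" where
  "pairs X = {P. P \<subseteq> X \<and> card P = 2}"

lemma pairs_iff: "P \<in> pairs X \<longleftrightarrow> (\<exists>x\<in>X. \<exists>y\<in>X. x \<noteq> y \<and> P = {x, y})"
  by (auto simp: pairs_def card_2_iff)

lemma pair_in_pairs: "x \<in> X \<Longrightarrow> y \<in> X \<Longrightarrow> x \<noteq> y \<Longrightarrow> {x, y} \<in> pairs X"
  by (auto simp: pairs_iff)

lemma pairs_other: "P \<in> pairs X \<Longrightarrow> a \<in> P \<Longrightarrow> \<exists>b. P = {a, b} \<and> a \<noteq> b"
  by (auto simp: pairs_iff)

lemma pairs_eqI: "P \<in> pairs X \<Longrightarrow> a \<in> P \<Longrightarrow> b \<in> P \<Longrightarrow> a \<noteq> b \<Longrightarrow> P = {a, b}"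
  by (auto simp: pairs_iff)

text \<open>Three pairs through a common point meet pairwise without forming a triangle; hence so do their
  images, which therefore have a common point again.\<close>

lemma permutation_of_pairs:
  assumes three: "x1 \<in> X" "x2 \<in> X" "x3 \<in> X" "x1 \<noteq> x2" "x1 \<noteq> x3" "x2 \<noteq> x3"
    and bij: "bij_betw G (pairs X) (pairs X)"
    and tri: "\<And>P Q T. P \<in> pairs X \<Longrightarrow> Q \<in> pairs X \<Longrightarrow> T \<in> pairs X \<Longrightarrow>
      P \<noteq> Q \<Longrightarrow> P \<noteq> T \<Longrightarrow> Q \<noteq> T \<Longrightarrow>
      P \<inter> Q \<noteq> {} \<and> T \<subseteq> P \<union> Q \<longleftrightarrow> G P \<inter> G Q \<noteq> {} \<and> G T \<subseteq> G P \<union> G Q"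
  shows "\<exists>p\<in>Bij X. \<forall>P\<in>pairs X. G P = p ` P"
proof -
  have Gmem: "G P \<in> pairs X" if "P \<in> pairs X" for P using bij that by (auto simp: bij_betw_def)
  have Geq: "G P = G Q \<longleftrightarrow> P = Q" if "P \<in> pairs X" "Q \<in> pairs X" for P Q
    using bij that by (auto simp: bij_betw_def inj_on_def)
  \<comment> \<open>The sides {x, y}, {x, z}, {y, z} form a triangle, so their images do, and sides
    of a triangle meet.\<close>
  have meet: "G {x, y} \<inter> G {x, z} \<noteq> {}"
    if "x \<in> X" "y \<in> X" "z \<in> X" "x \<noteq> y" "x \<noteq> z" "y \<noteq> z" for x y z
    using tri[of "{x, y}" "{x, z}" "{y, z}"] that by (auto simp: pair_in_pairs doubleton_eq_iff)
  have tri3: "G {x, w} \<subseteq> G {x, y} \<union> G {x, z} \<longleftrightarrow> w \<in> {y, z}"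
    if "x \<in> X" "y \<in> X" "z \<in> X" "w \<in> X" "x \<noteq> y" "x \<noteq> z" "y \<noteq> z" "w \<noteq> x" for x y z w
  proof (cases "w \<in> {y, z}")
    case False
    then show ?thesis
      using tri[of "{x, y}" "{x, z}" "{x, w}"] that meet[of x y z]
      by (auto simp: pair_in_pairs doubleton_eq_iff)
  qed auto
  have others: "\<exists>y\<in>X. \<exists>z\<in>X. x \<noteq> y \<and> x \<noteq> z \<and> y \<noteq> z" for x
    using three by (cases "x = x1"; cases "x = x2") blast+
  have common: "\<exists>a. \<forall>w\<in>X - {x}. a \<in> G {x, w}" if x: "x \<in> X" for x
  proof -
    obtain y z where yz: "y \<in> X" "z \<in> X" "x \<noteq> y" "x \<noteq> z" "y \<noteq> z" using others by blast
    obtain a where a: "a \<in> G {x, y}" "a \<in> G {x, z}" using meet[of x y z] x yz by blast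
    have "a \<in> G {x, w}" if w: "w \<in> X - {x}" for w
    proof (rule ccontr)
      \<comment> \<open>Without \<open>a\<close>, the third image would meet the other two in
        distinct points b and c and close the triangle {a, b}, {a, c}, {b, c}, against
        \<open>tri3\<close>.\<close>
      assume n: "a \<notin> G {x, w}"
      then have wyz: "w \<noteq> y" "w \<noteq> z" using a by auto
      obtain b where b: "b \<in> G {x, w}" "b \<in> G {x, y}" using meet[of x w y] x yz w wyz by blast
      obtain c where c: "c \<in> G {x, w}" "c \<in> G {x, z}" using meet[of x w z] x yz w wyz by blast
      have pm: "G {x, y} \<in> pairs X" "G {x, z} \<in> pairs X" "G {x, w} \<in> pairs X"
        using x yz w by (auto intro!: Gmem pair_in_pairs)
      have "a \<noteq> b" "a \<noteq> c" using n b c by auto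
      then have e: "G {x, y} = {a, b}" "G {x, z} = {a, c}"
        using pairs_eqI[OF pm(1) a(1) b(2)] pairs_eqI[OF pm(2) a(2) c(2)] by auto
      have "G {x, y} \<noteq> G {x, z}"
        using Geq[of "{x, y}" "{x, z}"] x yz by (auto simp: pair_in_pairs doubleton_eq_iff)
      then have "b \<noteq> c" using e by auto
      then have "G {x, w} = {b, c}" using pairs_eqI[OF pm(3) b(1) c(1)] by simp
      then show False using e tri3[of x y z w] x yz w wyz by auto
    qed
    then show ?thesis by blast
  qed
  define p where "p = (\<lambda>x\<in>X. SOME a. \<forall>w\<in>X - {x}. a \<in> G {x, w})"
  have p: "p x \<in> G {x, w}" if "x \<in> X" "w \<in> X" "w \<noteq> x" for x w
    using someI_ex[OF common[OF that(1)]] that by (simp add: p_def)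
  have pX: "p x \<in> X" if x: "x \<in> X" for x
  proof -
    obtain y where y: "y \<in> X" "x \<noteq> y" using others by blast
    then have "p x \<in> G {x, y}" "G {x, y} \<in> pairs X" using x by (auto intro!: p Gmem pair_in_pairs)
    then show ?thesis by (auto simp: pairs_def)
  qed
  have pinj: "p x \<noteq> p y" if xy: "x \<in> X" "y \<in> X" "x \<noteq> y" for x y
  proof
    \<comment> \<open>With a third point z, the images of all three sides of the triangle x, y, z
      contain \<open>?a\<close>. They form a triangle, so the last image {a, d} lies in {a, b, c};
      then d is b or c and two images coincide.\<close>
    assume e: "p x = p y"
    obtain z where z: "z \<in> X" "x \<noteq> z" "y \<noteq> z"
      using others[of x] xy(3) by metis
    let ?a = "p x"
    have P: "G {x, y} \<in> pairs X" "G {x, z} \<in> pairs X" "G {y, z} \<in> pairs X"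
      using xy z by (auto intro!: Gmem pair_in_pairs)
    have a: "?a \<in> G {x, y}" "?a \<in> G {x, z}" "?a \<in> G {y, z}"
      using p[of x y] p[of x z] p[of y z] xy z e by auto
    have "{x, y} \<noteq> {x, z}" "{x, y} \<noteq> {y, z}" "{x, z} \<noteq> {y, z}"
      using xy z by (auto simp: doubleton_eq_iff)
    moreover from this have "G {x, y} \<noteq> G {x, z}" "G {x, y} \<noteq> G {y, z}" "G {x, z} \<noteq> G {y, z}"
      using xy z by (auto simp: Geq pair_in_pairs)
    moreover have "G {y, z} \<subseteq> G {x, y} \<union> G {x, z}"
      using tri[of "{x, y}" "{x, z}" "{y, z}"] calculation xy z by (auto simp: pair_in_pairs)
    moreover obtain b where "G {x, y} = {?a, b}" using pairs_other[OF P(1) a(1)] by blast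
    moreover obtain c where "G {x, z} = {?a, c}" using pairs_other[OF P(2) a(2)] by blast
    moreover obtain d where "G {y, z} = {?a, d}" "?a \<noteq> d" using pairs_other[OF P(3) a(3)] by blast
    ultimately show False by auto
  qed
  have Gp: "G {x, y} = {p x, p y}" if "x \<in> X" "y \<in> X" "x \<noteq> y" for x y
    using pairs_eqI[OF Gmem[OF pair_in_pairs[OF that]] p[of x y] _ pinj[OF that]]
      p[of y x] that by (simp add: insert_commute)
  have "X \<subseteq> p ` X"
  proof
    fix a assume a: "a \<in> X"
    obtain b where b: "b \<in> X" "a \<noteq> b" using others by blast
    have "{a, b} \<in> G ` pairs X" using bij pair_in_pairs[OF a b] by (auto simp: bij_betw_def)
    then obtain x y where xy: "x \<in> X" "y \<in> X" "x \<noteq> y" "G {x, y} = {a, b}"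
      by (auto simp: pairs_iff)
    then have "a \<in> {p x, p y}" using Gp by blast
    then show "a \<in> p ` X" using xy by blast
  qed
  then have "p \<in> Bij X"
    unfolding Bij_def bij_betw_def inj_on_def using pX pinj by (auto simp: p_def)
  moreover have "G P = p ` P" if P: "P \<in> pairs X" for P
    using P Gp by (auto simp: pairs_iff)
  ultimately show ?thesis by blast
qed


section \<open>The dual symmetric inverse monoid\<close>

abbreviation BX :: "'a set \<Rightarrow> ('a \<times> 'a) set set" where
  "BX \<equiv> block_bijections"

abbreviation bmult :: "'a set \<Rightarrow> ('a \<times> 'a) set \<Rightarrow> ('a \<times> 'a) set \<Rightarrow> ('a \<times> 'a) set" where
  "bmult X R T \<equiv> R \<otimes>\<^bsub>dual_sym_inv_monoid X\<^esub> T"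

lemma carrier_dual [simp]: "carrier (dual_sym_inv_monoid X) = BX X"
  by (simp add: dual_sym_inv_monoid_def)

lemma BX_I:
  assumes "\<And>x y. (x, y) \<in> R \<Longrightarrow> x \<in> X \<and> y \<in> X" "\<And>x. x \<in> X \<Longrightarrow> \<exists>y. (x, y) \<in> R"
    "\<And>y. y \<in> X \<Longrightarrow> \<exists>x. (x, y) \<in> R"
    "\<And>x y z w. (x, y) \<in> R \<Longrightarrow> (z, y) \<in> R \<Longrightarrow> (z, w) \<in> R \<Longrightarrow> (x, w) \<in> R"
  shows "R \<in> BX X"
  unfolding block_bijections_iff
proof (intro conjI)
  show "R \<subseteq> X \<times> X" using assms(1) by auto
  show "X \<subseteq> Domain R" "X \<subseteq> Range R" using assms(2,3) by blast+
  show "R O R\<inverse> O R \<subseteq> R" using assms(4) by auto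
qed

lemma BX_mem: "R \<in> BX X \<Longrightarrow> (x, y) \<in> R \<Longrightarrow> x \<in> X \<and> y \<in> X"
  and BX_dom: "R \<in> BX X \<Longrightarrow> x \<in> X \<Longrightarrow> \<exists>y. (x, y) \<in> R"
  and BX_ran: "R \<in> BX X \<Longrightarrow> y \<in> X \<Longrightarrow> \<exists>x. (x, y) \<in> R"
  and BX_D: "R \<in> BX X \<Longrightarrow> (x, y) \<in> R \<Longrightarrow> (z, y) \<in> R \<Longrightarrow> (z, w) \<in> R \<Longrightarrow> (x, w) \<in> R"
  unfolding block_bijections_iff by blast+

lemma bmult_closed: "R \<in> BX X \<Longrightarrow> T \<in> BX X \<Longrightarrow> bmult X R T \<in> BX X"
  by (rule dual_sym_inv_mult(2))

lemma bmult_I: "R \<in> BX X \<Longrightarrow> T \<in> BX X \<Longrightarrow> (x, y) \<in> R \<Longrightarrow> (y, z) \<in> T \<Longrightarrow> (x, z) \<in> bmult X R T"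
  using dual_sym_inv_mult(3) by blast

lemma bmult_least: "R \<in> BX X \<Longrightarrow> T \<in> BX X \<Longrightarrow> V \<in> BX X \<Longrightarrow> R O T \<subseteq> V \<Longrightarrow> bmult X R T \<subseteq> V"
  using dual_sym_inv_mult(1) by blast

lemma bmult_eqI:
  assumes "R \<in> BX X" "T \<in> BX X" "U \<in> BX X" "R O T \<subseteq> U"
    "\<And>V. V \<in> BX X \<Longrightarrow> R O T \<subseteq> V \<Longrightarrow> U \<subseteq> V"
  shows "bmult X R T = U"
  using assms bmult_least[OF assms(1-4)] dual_sym_inv_mult(2,3)[OF assms(1,2)] by blast

lemma converse_BX: "R \<in> BX X \<Longrightarrow> R\<inverse> \<in> BX X"
  by (rule BX_I) (auto dest: BX_mem BX_dom BX_ran BX_D)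

text \<open>Converse reverses relational composites and preserves inclusion and block bijections, so
  it carries the least block bijection above one composite to that above the other.\<close>

lemma converse_bmult:
  assumes "R \<in> BX X" "T \<in> BX X"
  shows "(bmult X R T)\<inverse> = bmult X (T\<inverse>) (R\<inverse>)"
proof (rule bmult_eqI[symmetric])
  show "T\<inverse> O R\<inverse> \<subseteq> (bmult X R T)\<inverse>" using bmult_I[OF assms] by blast
  show "(bmult X R T)\<inverse> \<subseteq> V" if "V \<in> BX X" "T\<inverse> O R\<inverse> \<subseteq> V" for V
    using bmult_least[OF assms converse_BX[OF that(1)]] that(2) by blast
qed (use assms in \<open>auto intro: converse_BX bmult_closed\<close>)


subsection \<open>Conjugation\<close>

definition rel_conj :: "('a \<Rightarrow> 'a) \<Rightarrow> ('a \<times> 'a) set \<Rightarrow> ('a \<times> 'a) set" where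
  "rel_conj p R = (\<lambda>(x, y). (p x, p y)) ` R"

lemma rel_conj_iff: "(u, v) \<in> rel_conj p R \<longleftrightarrow> (\<exists>x y. (x, y) \<in> R \<and> u = p x \<and> v = p y)"
  by (auto simp: rel_conj_def)

lemma rel_conj_compose:
  "R \<in> BX X \<Longrightarrow> rel_conj (compose X p q) R = rel_conj p (rel_conj q R)"
  unfolding rel_conj_def image_image by (rule image_cong) (auto simp: compose_eq dest: BX_mem)

lemma rel_conj_id: "R \<in> BX X \<Longrightarrow> rel_conj (\<lambda>x\<in>X. x) R = R"
  unfolding rel_conj_def
  by (subst image_cong[OF refl, where g = id]) (auto dest: BX_mem)

lemma rel_conj_BX:
  assumes p: "p \<in> Bij X" and R: "R \<in> BX X"
  shows "rel_conj p R \<in> BX X"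
proof (rule BX_I)
  show "\<exists>y. (x, y) \<in> rel_conj p R" if "x \<in> X" for x
    using Bij_surj[OF p that] BX_dom[OF R] by (metis rel_conj_iff)
  show "\<exists>x. (x, y) \<in> rel_conj p R" if "y \<in> X" for y
    using Bij_surj[OF p that] BX_ran[OF R] by (metis rel_conj_iff)
  fix x y z w assume "(x, y) \<in> rel_conj p R" "(z, y) \<in> rel_conj p R" "(z, w) \<in> rel_conj p R"
  then show "(x, w) \<in> rel_conj p R"
    unfolding rel_conj_iff using BX_D[OF R] Bij_eq_iff[OF p] BX_mem[OF R] by metis
qed (use BX_mem[OF R] Bij_mem[OF p] in \<open>auto simp: rel_conj_iff\<close>)

lemma rel_conj_mono: "R \<subseteq> T \<Longrightarrow> rel_conj p R \<subseteq> rel_conj p T"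
  by (auto simp: rel_conj_def)

lemma rel_conj_relcomp:
  assumes p: "p \<in> Bij X" and "R \<in> BX X" "T \<in> BX X"
  shows "rel_conj p R O rel_conj p T = rel_conj p (R O T)"
proof
  show "rel_conj p R O rel_conj p T \<subseteq> rel_conj p (R O T)"
  proof clarify
    fix u v w assume "(u, v) \<in> rel_conj p R" "(v, w) \<in> rel_conj p T"
    then obtain x y y' z where *: "(x, y) \<in> R" "(y', z) \<in> T" "u = p x" "p y = p y'" "w = p z"
      by (auto simp: rel_conj_iff)
    then have "y = y'" using BX_mem[OF assms(2)] BX_mem[OF assms(3)] Bij_eq_iff[OF p] by metis
    then show "(u, w) \<in> rel_conj p (R O T)" using * by (auto simp: rel_conj_iff)
  qed
  show "rel_conj p (R O T) \<subseteq> rel_conj p R O rel_conj p T"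
    by (auto simp: rel_conj_def)
qed

text \<open>Conjugation by p is monotone on block bijections with monotone inverse, conjugation by
  q, so it commutes with taking the least one above a composite.\<close>

lemma rel_conj_bmult:
  assumes p: "p \<in> Bij X" and R: "R \<in> BX X" and T: "T \<in> BX X"
  shows "rel_conj p (bmult X R T) = bmult X (rel_conj p R) (rel_conj p T)"
proof (rule bmult_eqI[symmetric])
  note conj_RT = rel_conj_relcomp[OF p R T]
  obtain q where q: "q \<in> Bij X" "compose X p q = (\<lambda>x\<in>X. x)" "compose X q p = (\<lambda>x\<in>X. x)"
    using Bij_inverse[OF p] by metis
  have pq: "rel_conj p (rel_conj q U) = U" "rel_conj q (rel_conj p U) = U" if "U \<in> BX X" for U
    using rel_conj_compose[OF that, of p q] rel_conj_compose[OF that, of q p] q rel_conj_id[OF that]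
    by simp_all
  show "rel_conj p R O rel_conj p T \<subseteq> rel_conj p (bmult X R T)"
    unfolding conj_RT by (rule rel_conj_mono) (rule dual_sym_inv_mult(3)[OF R T])
  show "rel_conj p (bmult X R T) \<subseteq> V"
    if V: "V \<in> BX X" "rel_conj p R O rel_conj p T \<subseteq> V" for V
  proof -
    have "rel_conj q (rel_conj p R) O rel_conj q (rel_conj p T) \<subseteq> rel_conj q V"
      using rel_conj_mono[OF V(2), of q] rel_conj_relcomp[OF q(1) rel_conj_BX[OF p R] rel_conj_BX[OF p T]]
      by simp
    then have "bmult X R T \<subseteq> rel_conj q V"
      using pq R T by (intro bmult_least rel_conj_BX q V) auto
    then show ?thesis using rel_conj_mono[of _ "rel_conj q V" p] pq(1)[OF V(1)] by metis
  qed
qed (use assms in \<open>auto intro: rel_conj_BX bmult_closed\<close>)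


subsection \<open>Idempotents\<close>

text \<open>For P inside X, the equivalence whose only possibly nontrivial class is P; if P has at
  most one point this is the identity. Equivalences are the idempotents of the dual monoid.\<close>

definition collapse :: "'a set \<Rightarrow> 'a set \<Rightarrow> ('a \<times> 'a) set" where
  "collapse X P = Id_on X \<union> P \<times> P"

lemma collapse_iff: "(x, y) \<in> collapse X P \<longleftrightarrow> x \<in> X \<and> x = y \<or> x \<in> P \<and> y \<in> P"
  by (auto simp: collapse_def)

lemma collapse_BX: "P \<subseteq> X \<Longrightarrow> collapse X P \<in> BX X"
  by (rule BX_I) (auto simp: collapse_iff)

lemma Id_on_BX: "Id_on X \<in> BX X"
  by (rule BX_I) auto

text \<open>A reflexive \<open>e\<close> makes \<open>e O R\<close> contain \<open>R\<close>, so
  absorption, phrased through a least element, reduces to one inclusion of relations.\<close>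

lemma bmult_absorb_iff:
  assumes e: "e \<in> BX X" "Id_on X \<subseteq> e" and R: "R \<in> BX X"
  shows "bmult X e R = R \<longleftrightarrow> e O R \<subseteq> R"
proof
  assume "e O R \<subseteq> R"
  then show "bmult X e R = R"
  proof (rule bmult_eqI[OF e(1) R R])
    show "R \<subseteq> V" if "e O R \<subseteq> V" for V using that e(2) BX_mem[OF R] by fast
  qed
qed (use dual_sym_inv_mult(3)[OF e(1) R] in simp)

lemma Id_on_bmult: "R \<in> BX X \<Longrightarrow> bmult X (Id_on X) R = R"
  by (auto simp: bmult_absorb_iff Id_on_BX)

lemma bmult_Id_on: "R \<in> BX X \<Longrightarrow> bmult X R (Id_on X) = R"
  using converse_bmult[of "Id_on X" X "R\<inverse>"] by (simp add: Id_on_BX converse_BX Id_on_bmult)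

text \<open>Idempotency yields transitivity. From x -> y and w -> x follows w -> y, and
  difunctionality closes these three arrows to x -> x. With reflexivity, difunctionality becomes
  symmetry.\<close>

lemma idem_BX:
  assumes R: "R \<in> BX X" "bmult X R R = R"
  shows "Id_on X \<subseteq> R" "sym R" "trans R"
proof -
  show t: "trans R" using bmult_I[OF R(1) R(1)] unfolding R(2) by (rule transI)
  have refl: "(x, x) \<in> R" if x: "x \<in> X" for x
  proof -
    obtain y w where y: "(x, y) \<in> R" and w: "(w, x) \<in> R" using BX_dom BX_ran R(1) x by metis
    then have "(w, y) \<in> R" using t by (meson transD)
    then show ?thesis using BX_D[OF R(1) y _ w] by blast
  qed
  then show "Id_on X \<subseteq> R" by auto
  show "sym R" using BX_D[OF R(1)] refl BX_mem[OF R(1)] by (metis symI)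
qed

text \<open>The natural order of idempotents is reverse inclusion of equivalences.\<close>

lemma idem_le_iff:
  assumes "e \<in> BX X" "bmult X e e = e" "f \<in> BX X" "bmult X f f = f"
  shows "bmult X e f = f \<longleftrightarrow> e \<subseteq> f"
proof -
  have "e O f \<subseteq> f \<longleftrightarrow> e \<subseteq> f"
  proof
    assume "e O f \<subseteq> f"
    then show "e \<subseteq> f" using idem_BX(1)[OF assms(3,4)] BX_mem[OF assms(1)] by fast
  qed (use idem_BX(3)[OF assms(3,4)] in \<open>blast dest: transD\<close>)
  then show ?thesis using bmult_absorb_iff[OF assms(1) idem_BX(1)[OF assms(1,2)] assms(3)] by simp
qed

lemma collapse_refl: "Id_on X \<subseteq> collapse X P"
  by (auto simp: collapse_def)

lemma collapse_idem: "P \<subseteq> X \<Longrightarrow> bmult X (collapse X P) (collapse X P) = collapse X P"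
  by (subst bmult_absorb_iff) (auto simp: collapse_BX collapse_refl, auto simp: collapse_iff)

text \<open>Atoms are minimal with respect to inclusion; in the natural order of the monoid they are
  the maximal idempotents below the identity.\<close>

definition atom :: "'a set \<Rightarrow> ('a \<times> 'a) set \<Rightarrow> bool" where
  "atom X e \<longleftrightarrow> e \<in> BX X \<and> bmult X e e = e \<and> e \<noteq> Id_on X \<and>
     (\<forall>f\<in>BX X. bmult X f f = f \<and> bmult X f e = e \<longrightarrow> f = Id_on X \<or> f = e)"

lemma pairs_subset: "P \<in> pairs X \<Longrightarrow> P \<subseteq> X"
  by (simp add: pairs_def)

lemma collapse_pair_subset:
  assumes P: "P \<in> pairs X" and "P \<times> P \<subseteq> collapse X Q"
  shows "P \<subseteq> Q"
  using assms by (auto simp: pairs_iff collapse_def)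

lemma collapse_inj: "P \<in> pairs X \<Longrightarrow> Q \<in> pairs X \<Longrightarrow> collapse X P = collapse X Q \<longleftrightarrow> P = Q"
  using collapse_pair_subset[of P X Q] collapse_pair_subset[of Q X P]
  by (auto simp: collapse_def)

text \<open>An equivalence other than the identity relates two distinct points and so contains the
  collapse of that pair, below which only the identity remains.\<close>

lemma atom_iff: "atom X e \<longleftrightarrow> (\<exists>P\<in>pairs X. e = collapse X P)"
proof
  assume e: "atom X e"
  then have eB: "e \<in> BX X" "bmult X e e = e" "e \<noteq> Id_on X" by (auto simp: atom_def)
  note ei = idem_BX[OF eB(1,2)]
  obtain x y where xy: "(x, y) \<in> e" "x \<noteq> y"
  proof -
    have "\<not> e \<subseteq> Id_on X" using ei(1) eB(3) by blast
    then obtain x y where "(x, y) \<in> e" "(x, y) \<notin> Id_on X" by auto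
    then show thesis using that BX_mem[OF eB(1)] by auto
  qed
  then have X: "x \<in> X" "y \<in> X" using BX_mem[OF eB(1)] by auto
  let ?P = "{x, y}"
  have P: "?P \<in> pairs X" using X xy(2) by (rule pair_in_pairs)
  have "collapse X ?P \<subseteq> e" using ei X xy by (auto simp: collapse_def dest: symD)
  then have "bmult X (collapse X ?P) e = e"
    using idem_le_iff[OF collapse_BX collapse_idem eB(1,2)] pairs_subset[OF P] by blast
  moreover have "collapse X ?P \<noteq> Id_on X" using xy by (auto simp: collapse_def)
  ultimately have "collapse X ?P = e"
    using e collapse_BX[OF pairs_subset[OF P]] collapse_idem[OF pairs_subset[OF P]]
    unfolding atom_def by blast
  then show "\<exists>P\<in>pairs X. e = collapse X P" using P by blast
next
  assume "\<exists>P\<in>pairs X. e = collapse X P"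
  then obtain x y where xy: "x \<in> X" "y \<in> X" "x \<noteq> y" and e: "e = collapse X {x, y}"
    by (auto simp: pairs_iff)
  have P: "{x, y} \<subseteq> X" using xy by simp
  have "f = Id_on X \<or> f = e" if f: "f \<in> BX X" "bmult X f f = f" "bmult X f e = e" for f
  proof -
    note fi = idem_BX[OF f(1,2)]
    have sub: "f \<subseteq> e"
      using idem_le_iff[OF f(1,2) collapse_BX[OF P] collapse_idem[OF P]] f(3) e by simp
    show ?thesis
    proof (cases "(x, y) \<in> f")
      case True
      then have "e \<subseteq> f" using fi xy unfolding e by (auto simp: collapse_def dest: symD)
      then show ?thesis using sub by blast
    next
      case False
      then have "(y, x) \<notin> f" using fi(2) by (meson symD)
      then have "f \<subseteq> Id_on X" using False sub BX_mem[OF f(1)] unfolding e by (auto simp: collapse_def)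
      then show ?thesis using fi(1) by blast
    qed
  qed
  then show "atom X e"
    unfolding atom_def using xy collapse_BX[OF P] collapse_idem[OF P]
    by (auto simp: e) (auto simp: collapse_def)
qed

text \<open>All source blocks of R meeting P are merged, and so are their target blocks: the
  right-hand factor of the added rectangle is the union of these target blocks, the left-hand one
  that of the source blocks. This makes products with atoms computable.\<close>

lemma collapse_bmult:
  assumes P: "P \<subseteq> X" and R: "R \<in> BX X"
  shows "bmult X (collapse X P) R = R \<union> (R\<inverse> `` (R `` P)) \<times> (R `` P)"
proof (rule bmult_eqI)
  let ?U = "R \<union> (R\<inverse> `` (R `` P)) \<times> (R `` P)"
  show "?U \<in> BX X"
  proof (rule BX_I)
    fix x y z w assume "(x, y) \<in> ?U" "(z, y) \<in> ?U" "(z, w) \<in> ?U"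
    then show "(x, w) \<in> ?U" using BX_D[OF R] by blast
  qed (use BX_mem[OF R] BX_dom[OF R] BX_ran[OF R] in blast)+
  show "collapse X P O R \<subseteq> ?U" using BX_dom[OF R] P by (fastforce simp: collapse_iff)
  fix V assume V: "V \<in> BX X" "collapse X P O R \<subseteq> V"
  have RV: "R \<subseteq> V" using V(2) BX_mem[OF R] by (fastforce simp: collapse_iff)
  moreover have "(R\<inverse> `` (R `` P)) \<times> (R `` P) \<subseteq> V"
  proof clarify
    fix a b c d e assume *: "c \<in> P" "(c, d) \<in> R" "(a, d) \<in> R" "e \<in> P" "(e, b) \<in> R"
    have "(c, e) \<in> collapse X P" using * by (simp add: collapse_iff)
    then have "(c, b) \<in> V" using * V(2) by blast
    then show "(a, b) \<in> V" using BX_D[OF V(1)] * RV by blast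
  qed
  ultimately show "?U \<subseteq> V" by blast
qed (use collapse_BX[OF P] R in auto)

lemma bmult_collapse:
  assumes P: "P \<subseteq> X" and R: "R \<in> BX X"
  shows "bmult X R (collapse X P) = R \<union> (R\<inverse> `` P) \<times> (R `` (R\<inverse> `` P))"
proof -
  have "(collapse X P)\<inverse> = collapse X P" by (auto simp: collapse_def)
  then have "bmult X R (collapse X P) = (bmult X (collapse X P) (R\<inverse>))\<inverse>"
    using converse_bmult[OF collapse_BX[OF P] converse_BX[OF R]] by simp
  then show ?thesis using collapse_bmult[OF P converse_BX[OF R]] by auto
qed

text \<open>If P and Q meet, the product of their atoms has the single class P \<union> Q; if they
  are disjoint, it keeps P and Q as separate classes and can absorb no third pair.\<close>

lemma triangle_iff:
  assumes P: "P \<in> pairs X" and Q: "Q \<in> pairs X" and T: "T \<in> pairs X"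
    and ne: "P \<noteq> Q" "P \<noteq> T" "Q \<noteq> T"
  shows "bmult X (collapse X T) (bmult X (collapse X P) (collapse X Q)) =
      bmult X (collapse X P) (collapse X Q) \<longleftrightarrow> P \<inter> Q \<noteq> {} \<and> T \<subseteq> P \<union> Q"
proof -
  note sub = pairs_subset[OF P] pairs_subset[OF Q] pairs_subset[OF T]
  let ?e = "bmult X (collapse X P) (collapse X Q)"
  have eB: "?e \<in> BX X" by (intro bmult_closed collapse_BX sub)
  have abs: "bmult X (collapse X T) ?e = ?e \<longleftrightarrow> collapse X T O ?e \<subseteq> ?e"
    by (rule bmult_absorb_iff[OF collapse_BX[OF sub(3)] collapse_refl eB])
  obtain x y where xy: "x \<in> X" "y \<in> X" "x \<noteq> y" "T = {x, y}" using T by (auto simp: pairs_iff)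
  show ?thesis
  proof (cases "P \<inter> Q = {}")
    case True
    have "?e = collapse X P \<union> collapse X Q"
      unfolding collapse_bmult[OF sub(1) collapse_BX[OF sub(2)]]
    proof -
      have "collapse X Q `` P = P" "(collapse X Q)\<inverse> `` P = P"
        using True sub by (auto simp: collapse_def)
      then show "collapse X Q \<union> ((collapse X Q)\<inverse> `` (collapse X Q `` P)) \<times> (collapse X Q `` P) =
          collapse X P \<union> collapse X Q"
        by (auto simp: collapse_def)
    qed
    moreover have "(x, y) \<notin> collapse X P \<union> collapse X Q"
      using pairs_eqI[OF P, of x y] pairs_eqI[OF Q, of x y] xy ne by (auto simp: collapse_def)
    moreover have "(x, y) \<in> collapse X T O (collapse X P \<union> collapse X Q)"
      using xy by (auto simp: collapse_def)
    ultimately show ?thesis using abs True by auto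
  next
    case False
    then have e: "?e = collapse X (P \<union> Q)"
      unfolding collapse_bmult[OF sub(1) collapse_BX[OF sub(2)]]
    proof -
      have "collapse X Q `` P = P \<union> Q" "(collapse X Q)\<inverse> `` (P \<union> Q) = P \<union> Q"
        using False sub by (auto simp: collapse_def)
      then show "collapse X Q \<union> ((collapse X Q)\<inverse> `` (collapse X Q `` P)) \<times> (collapse X Q `` P) =
          collapse X (P \<union> Q)"
        by (auto simp: collapse_def)
    qed
    have "collapse X T O collapse X (P \<union> Q) \<subseteq> collapse X (P \<union> Q) \<longleftrightarrow> T \<subseteq> P \<union> Q"
      using xy by (auto simp: collapse_def)
    then show ?thesis using abs e False by simp
  qed
qed


subsection \<open>Endomorphisms fixing all atoms\<close>

text \<open>For a block bijection this is the equivalence \<alpha> of its source blocks;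
  \<open>ker (R\<inverse>)\<close> is the equivalence \<beta> of its target blocks.\<close>

definition ker :: "('a \<times> 'a) set \<Rightarrow> 'a \<Rightarrow> 'a \<Rightarrow> bool" where
  "ker R x z \<longleftrightarrow> (\<exists>y. (x, y) \<in> R \<and> (z, y) \<in> R)"

lemma ker_sym: "ker R x z \<Longrightarrow> ker R z x"
  by (auto simp: ker_def)

lemma ker_I: "(x, y) \<in> R \<Longrightarrow> (z, y) \<in> R \<Longrightarrow> ker R x z"
  by (auto simp: ker_def)

lemma ker_D: "R \<in> BX X \<Longrightarrow> ker R x z \<Longrightarrow> (x, y) \<in> R \<Longrightarrow> (z, y) \<in> R"
  unfolding ker_def using BX_D by metis

lemma coker_D: "R \<in> BX X \<Longrightarrow> ker (R\<inverse>) y w \<Longrightarrow> (x, y) \<in> R \<Longrightarrow> (x, w) \<in> R"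
  using ker_D[OF converse_BX, of R X y w x] by simp

lemma ker_trans: "R \<in> BX X \<Longrightarrow> ker R x y \<Longrightarrow> ker R y z \<Longrightarrow> ker R x z"
  unfolding ker_def using BX_D by metis

text \<open>Left absorption of atoms reads off the kernel, so an injective multiplicative map that
  fixes the atoms preserves kernels and, dually, cokernels.\<close>

lemma ker_iff_bmult:
  assumes R: "R \<in> BX X" and xz: "x \<in> X" "z \<in> X"
  shows "bmult X (collapse X {x, z}) R = R \<longleftrightarrow> ker R x z"
proof -
  have B: "collapse X {x, z} \<in> BX X" using xz by (intro collapse_BX) simp
  have "collapse X {x, z} O R \<subseteq> R \<longleftrightarrow> ker R x z"
  proof
    assume a: "collapse X {x, z} O R \<subseteq> R"
    obtain y where y: "(x, y) \<in> R" using BX_dom[OF R xz(1)] by blast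
    have "(z, x) \<in> collapse X {x, z}" by (simp add: collapse_iff)
    then have "(z, y) \<in> R" using a y by blast
    then show "ker R x z" using y by (auto simp: ker_def)
  next
    assume k: "ker R x z"
    show "collapse X {x, z} O R \<subseteq> R"
      using ker_D[OF R k] ker_D[OF R ker_sym[OF k]] by (auto simp: collapse_iff)
  qed
  then show ?thesis using bmult_absorb_iff[OF B collapse_refl R] by simp
qed

lemma coker_iff_bmult:
  assumes R: "R \<in> BX X" and yw: "y \<in> X" "w \<in> X"
  shows "bmult X R (collapse X {y, w}) = R \<longleftrightarrow> ker (R\<inverse>) y w"
proof -
  have B: "collapse X {y, w} \<in> BX X" using yw by (intro collapse_BX) simp
  have "(collapse X {y, w})\<inverse> = collapse X {y, w}" by (auto simp: collapse_def)
  then have "(bmult X R (collapse X {y, w}))\<inverse> = bmult X (collapse X {y, w}) (R\<inverse>)"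
    using converse_bmult[OF R B] by simp
  then show ?thesis using ker_iff_bmult[OF converse_BX[OF R] yw] by (metis converse_converse)
qed

text \<open>Block bijections grow only by merging blocks. If B has (x, y), then A has some (x', y);
  so x and x' lie in one block of B, hence of A, and A has (x, y) too.\<close>

lemma BX_eqI_ker:
  assumes A: "A \<in> BX X" and B: "B \<in> BX X" and sub: "A \<subseteq> B"
    and k: "\<And>x z. x \<in> X \<Longrightarrow> z \<in> X \<Longrightarrow> ker B x z \<Longrightarrow> ker A x z"
  shows "A = B"
proof
  show "B \<subseteq> A"
  proof clarify
    fix x y assume xy: "(x, y) \<in> B"
    then obtain x' where x': "(x', y) \<in> A" using BX_mem[OF B] BX_ran[OF A] by metis
    then have "ker B x x'" using xy sub by (auto simp: ker_def)
    then have "ker A x' x" using k xy x' BX_mem[OF A] BX_mem[OF B] ker_sym by metis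
    then show "(x, y) \<in> A" using ker_D[OF A _ x'] by blast
  qed
qed (rule sub)

text \<open>Allowing x = z in the last assumption includes that \<open>F\<close> fixes the identity,
  which is \<open>collapse X {x, x}\<close>.\<close>

locale atom_fixing =
  fixes X :: "'a set" and F :: "('a \<times> 'a) set \<Rightarrow> ('a \<times> 'a) set"
  assumes F_mem: "R \<in> BX X \<Longrightarrow> F R \<in> BX X"
    and F_inj: "R \<in> BX X \<Longrightarrow> T \<in> BX X \<Longrightarrow> F R = F T \<Longrightarrow> R = T"
    and F_mult: "R \<in> BX X \<Longrightarrow> T \<in> BX X \<Longrightarrow> F (bmult X R T) = bmult X (F R) (F T)"
    and F_collapse: "x \<in> X \<Longrightarrow> z \<in> X \<Longrightarrow> F (collapse X {x, z}) = collapse X {x, z}"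
begin

lemma collapse2_BX: "x \<in> X \<Longrightarrow> z \<in> X \<Longrightarrow> collapse X {x, z} \<in> BX X"
  by (rule collapse_BX) simp

lemma F_collapse_bmult:
  "R \<in> BX X \<Longrightarrow> x \<in> X \<Longrightarrow> z \<in> X \<Longrightarrow>
    F (bmult X (collapse X {x, z}) R) = bmult X (collapse X {x, z}) (F R)"
  "R \<in> BX X \<Longrightarrow> x \<in> X \<Longrightarrow> z \<in> X \<Longrightarrow>
    F (bmult X R (collapse X {x, z})) = bmult X (F R) (collapse X {x, z})"
  by (simp_all add: F_mult collapse2_BX F_collapse)

lemma ker_F:
  assumes R: "R \<in> BX X" and xz: "x \<in> X" "z \<in> X"
  shows "ker (F R) x z \<longleftrightarrow> ker R x z"
proof -
  have "ker (F R) x z \<longleftrightarrow> F (bmult X (collapse X {x, z}) R) = F R"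
    using ker_iff_bmult[OF F_mem[OF R] xz] F_collapse_bmult(1)[OF R xz] by simp
  also have "\<dots> \<longleftrightarrow> bmult X (collapse X {x, z}) R = R"
    using F_inj[OF bmult_closed[OF collapse2_BX[OF xz] R] R] by auto
  finally show ?thesis using ker_iff_bmult[OF R xz] by simp
qed

lemma coker_F:
  assumes R: "R \<in> BX X" and xz: "x \<in> X" "z \<in> X"
  shows "ker ((F R)\<inverse>) x z \<longleftrightarrow> ker (R\<inverse>) x z"
proof -
  have "ker ((F R)\<inverse>) x z \<longleftrightarrow> F (bmult X R (collapse X {x, z})) = F R"
    using coker_iff_bmult[OF F_mem[OF R] xz] F_collapse_bmult(2)[OF R xz] by simp
  also have "\<dots> \<longleftrightarrow> bmult X R (collapse X {x, z}) = R"
    using F_inj[OF bmult_closed[OF R collapse2_BX[OF xz]] R] by auto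
  finally show ?thesis using coker_iff_bmult[OF R xz] by simp
qed

lemma F_eqI: "R \<in> BX X \<Longrightarrow> R \<subseteq> F R \<Longrightarrow> F R = R"
  using BX_eqI_ker[OF _ F_mem] ker_F by metis

text \<open>Merging the blocks of \<open>x\<close> and \<open>z\<close> in \<open>R\<close> can be done by multiplying with an atom on either
  side; as \<open>F\<close> respects this, \<open>F R\<close> maps the pair of blocks of \<open>x\<close> and \<open>z\<close> to the same pair of
  blocks as \<open>R\<close>.\<close>

lemma F_pair:
  assumes R: "R \<in> BX X" and xy: "(x, y) \<in> R" and zw: "(z, w) \<in> R" and nk: "\<not> ker R x z"
  shows "(x, y) \<in> F R \<and> (z, w) \<in> F R \<or> (x, w) \<in> F R \<and> (z, y) \<in> F R"
proof -
  let ?T = "F R"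
  note T = F_mem[OF R]
  have X: "x \<in> X" "y \<in> X" "z \<in> X" "w \<in> X" using BX_mem[OF R] xy zw by auto
  have sub: "{x, z} \<subseteq> X" "{y, w} \<subseteq> X" using X by auto
  have 1: "R\<inverse> `` (R `` {x, z}) = R\<inverse> `` {y, w}"
    using xy zw BX_D[OF R] by blast
  have 2: "R `` {x, z} = R `` (R\<inverse> `` {y, w})"
    using xy zw BX_D[OF R] by blast
  have "bmult X (collapse X {x, z}) R = bmult X R (collapse X {y, w})"
    unfolding collapse_bmult[OF sub(1) R] bmult_collapse[OF sub(2) R]
    by (simp only: 1 2[symmetric])
  then have e: "bmult X (collapse X {x, z}) ?T = bmult X ?T (collapse X {y, w})"
    using F_collapse_bmult[OF R] X by metis
  have nk': "\<not> ker ?T x z" using nk ker_F[OF R] X by simp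
  obtain p q where p: "(x, p) \<in> ?T" and q: "(z, q) \<in> ?T" using BX_dom[OF T] X by metis
  \<comment> \<open>Merging x with z on the left creates these two arrows, which \<open>F R\<close>
    lacks. On the right they can come only from the merged rectangle, so x and z are both matched
    with y or w.\<close>
  have "(x, q) \<in> bmult X ?T (collapse X {y, w})" "(z, p) \<in> bmult X ?T (collapse X {y, w})"
    unfolding e[symmetric] collapse_bmult[OF sub(1) T] using p q by auto
  moreover have "(x, q) \<notin> ?T" "(z, p) \<notin> ?T" using p q nk' by (auto simp: ker_def)
  ultimately have "(x, y) \<in> ?T \<or> (x, w) \<in> ?T" "(z, y) \<in> ?T \<or> (z, w) \<in> ?T"
    unfolding bmult_collapse[OF sub(2) T] by auto
  then show ?thesis using nk' by (auto simp: ker_def)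
qed

text \<open>Comparing the block of x with two further blocks, \<open>F_pair\<close> matches it under
  \<open>F R\<close> with y or w and also with y or v. Since w and v lie in different target blocks,
  only y is possible.\<close>

lemma F_fixes_rank_ge_3:
  assumes R: "R \<in> BX X" and X: "p \<in> X" "q \<in> X" "r \<in> X"
    and nk: "\<not> ker R p q" "\<not> ker R p r" "\<not> ker R q r"
  shows "F R = R"
proof (rule F_eqI[OF R])
  show "R \<subseteq> F R"
  proof clarify
    fix x y assume xy: "(x, y) \<in> R"
    \<comment> \<open>The block of x contains at most one of p, q, r, so two of them lie in further
      blocks.\<close>
    obtain z u where zu: "z \<in> X" "u \<in> X" "\<not> ker R x z" "\<not> ker R x u" "\<not> ker R z u"
    proof -
      have "\<not> ker R a b" if "ker R x c" "\<not> ker R c b" "a = x" for a b c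
        using that ker_trans[OF R] ker_sym by metis
      then show thesis using that[of p q] that[of p r] that[of q r] X nk ker_sym by metis
    qed
    obtain w v where w: "(z, w) \<in> R" and v: "(u, v) \<in> R" using BX_dom[OF R] zu by metis
    show "(x, y) \<in> F R"
    proof (rule ccontr)
      assume "(x, y) \<notin> F R"
      then have "(x, w) \<in> F R" "(x, v) \<in> F R"
        using F_pair[OF R xy w zu(3)] F_pair[OF R xy v zu(4)] by auto
      then have "ker ((F R)\<inverse>) w v" by (auto simp: ker_def)
      then have "ker (R\<inverse>) w v" using coker_F[OF R] BX_mem[OF R] w v by metis
      then have "(z, v) \<in> R" using coker_D[OF R _ w] by blast
      then show False using zu(5) v by (auto simp: ker_def)
    qed
  qed
qed

text \<open>If \<open>R\<close> has two matched non-singleton blocks then both can be split in two, so that \<open>R\<close> is the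
  product of an atom and a block bijection of larger rank.\<close>

lemma F_fixes_splittable:
  assumes R: "R \<in> BX X" and xy: "(x, y) \<in> R" and z: "ker R x z" "z \<noteq> x"
    and w: "ker (R\<inverse>) y w" "w \<noteq> y" and ne: "R \<noteq> X \<times> X"
  shows "F R = R"
proof -
  \<comment> \<open>R1 splits the block pair of (x, y): the singleton {x} is matched with {y} and
    the rest, containing z, with the rest, containing w. Other blocks stay.\<close>
  define R1 where "R1 = {(u, v). (u, v) \<in> R \<and> ((u, y) \<in> R \<longrightarrow> (u = x \<longleftrightarrow> v = y))}"
  note D = BX_D[OF R]
  have R1: "(u, v) \<in> R1 \<longleftrightarrow> (u, v) \<in> R \<and> ((u, y) \<in> R \<longrightarrow> (u = x \<longleftrightarrow> v = y))" for u v
    by (simp add: R1_def)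
  have zy: "(z, y) \<in> R" using ker_D[OF R z(1) xy] .
  have xw: "(x, w) \<in> R" using coker_D[OF R w(1) xy] .
  have X: "x \<in> X" "y \<in> X" "z \<in> X" "w \<in> X" using BX_mem[OF R] xy zy xw by auto
  have R1B: "R1 \<in> BX X"
  proof (rule BX_I)
    show "u \<in> X \<and> v \<in> X" if "(u, v) \<in> R1" for u v using that BX_mem[OF R] by (auto simp: R1)
    show "\<exists>v. (u, v) \<in> R1" if u: "u \<in> X" for u
    proof (cases "(u, y) \<in> R \<and> u \<noteq> x")
      case True
      then have "(u, w) \<in> R" using D xy xw by blast
      then show ?thesis using True w(2) by (auto simp: R1)
    next
      case False
      then show ?thesis using BX_dom[OF R u] xy by (auto simp: R1)
    qed
    show "\<exists>u. (u, v) \<in> R1" if v: "v \<in> X" for v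
    proof (cases "(x, v) \<in> R \<and> v \<noteq> y")
      case True
      then have "(z, v) \<in> R" using D xy zy by blast
      then show ?thesis using True z(2) by (auto simp: R1)
    next
      case False
      then show ?thesis using BX_ran[OF R v] xy D by (metis R1)
    qed
    fix a b c d assume "(a, b) \<in> R1" "(c, b) \<in> R1" "(c, d) \<in> R1"
    then have *: "(a, b) \<in> R" "(c, b) \<in> R" "(c, d) \<in> R"
      "(a, y) \<in> R \<Longrightarrow> (a = x \<longleftrightarrow> b = y)" "(c, y) \<in> R \<Longrightarrow> (c = x \<longleftrightarrow> b = y)"
      "(c, y) \<in> R \<Longrightarrow> (c = x \<longleftrightarrow> d = y)" by (auto simp: R1)
    have "(a, d) \<in> R" using D * by blast
    moreover have "(c, y) \<in> R" if "(a, y) \<in> R" using D *(1,2) that by blast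
    ultimately show "(a, d) \<in> R1" using * by (auto simp: R1)
  qed
  have eq: "bmult X (collapse X {x, z}) R1 = R"
  proof (rule bmult_eqI[OF collapse2_BX[OF X(1,3)] R1B R])
    show "collapse X {x, z} O R1 \<subseteq> R"
      using ker_D[OF R z(1)] ker_D[OF R ker_sym[OF z(1)]] by (auto simp: collapse_iff R1)
    fix V assume V: "V \<in> BX X" and sub: "collapse X {x, z} O R1 \<subseteq> V"
    have R1V: "R1 \<subseteq> V" using sub BX_mem[OF R1B] by (fastforce simp: collapse_iff)
    have xV: "(x, v) \<in> V" if "(z, v) \<in> R1" for v
    proof -
      have "(x, z) \<in> collapse X {x, z}" by (simp add: collapse_iff)
      then show ?thesis using that sub by blast
    qed
    show "R \<subseteq> V"
    proof clarify
      fix u v assume uv: "(u, v) \<in> R"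
      consider "(u, v) \<in> R1" | "u = x" "v \<noteq> y" | "u \<noteq> x" "v = y" using uv by (auto simp: R1)
      then show "(u, v) \<in> V"
      proof cases
        case 2
        then have "(z, v) \<in> R1" using uv ker_D[OF R z(1), of v] z(2) by (simp add: R1)
        then show ?thesis using xV 2 by blast
      next
        case 3
        \<comment> \<open>The missing arrow u -> y arises by difunctionality from u -> w, x -> w and
          x -> y, the middle one being created by merging x with z.\<close>
        have "(u, w) \<in> R1" using uv 3 D[of u y x w] xy xw w(2) by (simp add: R1)
        moreover have "(z, w) \<in> R1" using ker_D[OF R z(1) xw] w(2) z(2) by (simp add: R1)
        moreover have "(x, y) \<in> R1" using xy by (simp add: R1)
        ultimately show ?thesis using R1V xV[of w] BX_D[OF V, of u w x y] 3(2) by blast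
      qed (use R1V in blast)
    qed
  qed
  \<comment> \<open>As R is not the full relation, some \<open>a\<close> lies outside the block of
    x; then x, z and \<open>a\<close> are in three different blocks of R1.\<close>
  obtain a where a: "a \<in> X" "(a, y) \<notin> R"
  proof -
    have False if all: "\<And>a. a \<in> X \<Longrightarrow> (a, y) \<in> R"
    proof -
      have "X \<times> X \<subseteq> R"
      proof clarify
        fix u v assume "u \<in> X" "v \<in> X"
        then obtain c where "(c, v) \<in> R" using BX_ran[OF R] by blast
        then show "(u, v) \<in> R"
          using D[of u y c v] all[OF \<open>u \<in> X\<close>] all[of c] BX_mem[OF R, of c v] by blast
      qed
      then show False using ne BX_mem[OF R] by auto
    qed
    then show thesis using that by blast
  qed
  have "F R1 = R1"
  proof (rule F_fixes_rank_ge_3[OF R1B X(1) X(3) a(1)])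
    show "\<not> ker R1 x z" using xy zy z(2) by (auto simp: ker_def R1)
    show "\<not> ker R1 x a" using xy a(2) by (auto simp: ker_def R1)
    show "\<not> ker R1 z a" using zy a(2) D[of a _ z y] by (auto simp: ker_def R1)
  qed
  then show ?thesis using F_collapse_bmult(1)[OF R1B X(1,3)] eq by simp
qed

text \<open>A block bijection of rank two without matched non-singleton blocks is determined by the other
  block bijection with the same blocks, which does have such blocks.\<close>

lemma F_fixes_all:
  assumes three: "x1 \<in> X" "x2 \<in> X" "x3 \<in> X" "x1 \<noteq> x2" "x1 \<noteq> x3" "x2 \<noteq> x3"
    and R: "R \<in> BX X"
  shows "F R = R"
proof (rule ccontr)
  assume nF: "F R \<noteq> R"
  note D = BX_D[OF R] and T = F_mem[OF R]
  have rank2: "ker R p q \<or> ker R p r \<or> ker R q r" if "p \<in> X" "q \<in> X" "r \<in> X" for p q r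
    using F_fixes_rank_ge_3[OF R that] nF by blast
  have nsplit: False if "(x, y) \<in> R" "ker R x z" "z \<noteq> x" "ker (R\<inverse>) y w" "w \<noteq> y" "R \<noteq> X \<times> X" for x y z w
    using F_fixes_splittable[OF R that] nF by blast
  \<comment> \<open>The rank one case: with a single block there is nothing to match, and the kernel
    alone decides.\<close>
  have ne: "R \<noteq> X \<times> X"
  proof
    assume e: "R = X \<times> X"
    have "F R = X \<times> X"
    proof (rule BX_eqI_ker[OF T R[unfolded e]])
      show "F R \<subseteq> X \<times> X" using BX_mem[OF T] by auto
    qed (use ker_F[OF R] e in auto)
    then show False using nF e by simp
  qed
  then obtain a b where ab: "a \<in> X" "b \<in> X" "(a, b) \<notin> R" using BX_mem[OF R] by auto
  obtain b' where ab': "(a, b') \<in> R" using BX_dom[OF R ab(1)] by blast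
  obtain a' where a'b: "(a', b) \<in> R" using BX_ran[OF R ab(2)] by blast
  have X': "a' \<in> X" "b' \<in> X" using BX_mem[OF R] ab' a'b by auto
  have nk: "\<not> ker R a a'" using ker_D[OF R ker_sym a'b] ab(3) by blast
  have blocks: "ker R u a \<or> ker R u a'" if "u \<in> X" for u
    using rank2[OF that ab(1) X'(1)] nk by blast
  \<comment> \<open>With exactly two blocks on each side, the complement of R is the same pair of
    partitions matched the other way.\<close>
  define R' where "R' = X \<times> X - R"
  have R'_iff: "(u, v) \<in> R' \<longleftrightarrow> u \<in> X \<and> v \<in> X \<and> (u, v) \<notin> R" for u v by (auto simp: R'_def)
  have R'B: "R' \<in> BX X"
  proof (rule BX_I)
    show "\<exists>v. (u, v) \<in> R'" if u: "u \<in> X" for u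
    proof (cases "(u, b) \<in> R")
      case True
      then have "(u, b') \<notin> R" using D[of a b' u b] ab' ab(3) by blast
      then show ?thesis using u X' by (auto simp: R'_iff)
    qed (use u ab in \<open>auto simp: R'_iff\<close>)
    show "\<exists>u. (u, v) \<in> R'" if v: "v \<in> X" for v
    proof (cases "(a, v) \<in> R")
      case True
      then have "(a', v) \<notin> R" using nk by (auto simp: ker_def)
      then show ?thesis using v X' by (auto simp: R'_iff)
    qed (use v ab in \<open>auto simp: R'_iff\<close>)
    fix u v s t assume *: "(u, v) \<in> R'" "(s, v) \<in> R'" "(s, t) \<in> R'"
    have "(u, t) \<notin> R"
    proof
      assume ut: "(u, t) \<in> R"
      obtain m where m: "(m, v) \<in> R" using * BX_ran[OF R] by (auto simp: R'_iff)
      have X3: "u \<in> X" "s \<in> X" "m \<in> X" using * m BX_mem[OF R] by (auto simp: R'_iff)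
      have "\<not> ker R u s" using ker_D[OF R _ ut] * by (auto simp: R'_iff)
      moreover have "\<not> ker R u m" using ker_D[OF R ker_sym m] * by (auto simp: R'_iff)
      moreover have "\<not> ker R s m" using ker_D[OF R ker_sym m] * by (auto simp: R'_iff)
      ultimately show False using rank2[OF X3] by blast
    qed
    then show "(u, t) \<in> R'" using * by (auto simp: R'_iff)
  qed (auto simp: R'_iff)
  \<comment> \<open>Two of three points, x and z, share a source block of R. As R cannot be split,
    their target block is the singleton {y}, so the other target block has at least two points w and
    v. R' matches these two large blocks and can be split.\<close>
  have FR': "F R' = R'"
  proof -
    obtain x z where xz: "x \<in> X" "z \<in> X" "x \<noteq> z" "ker R x z"
      using rank2[OF three(1-3)] three by blast
    obtain y where xy: "(x, y) \<in> R" using BX_dom[OF R xz(1)] by blast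
    have zy: "(z, y) \<in> R" using ker_D[OF R xz(4) xy] .
    obtain w v where wv: "w \<in> X" "v \<in> X" "w \<noteq> y" "v \<noteq> y" "w \<noteq> v"
      using three by (cases "x1 = y"; cases "x2 = y") blast+
    have n: "(u, t) \<notin> R" if u: "(u, y) \<in> R" "u = x \<or> u = z" and t: "t \<noteq> y" for u t
    proof
      assume "(u, t) \<in> R"
      then have "ker (R\<inverse>) y t" using u by (auto simp: ker_def)
      then show False using nsplit[OF xy xz(4) xz(3)[symmetric] _ t ne] by blast
    qed
    have R's: "(x, w) \<in> R'" "(z, w) \<in> R'" "(x, v) \<in> R'"
      using n xy zy wv xz by (auto simp: R'_iff)
    show ?thesis
    proof (rule F_fixes_splittable[OF R'B R's(1), where z = z and w = v])
      show "ker R' x z" using R's by (rule_tac ker_I)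
      show "ker (R'\<inverse>) w v" using R's by (auto simp: ker_def)
      show "R' \<noteq> X \<times> X" using xy BX_mem[OF R xy] by (auto simp: R'_def)
    qed (use xz wv in auto)
  qed
  \<comment> \<open>\<open>F R\<close> has the same blocks as R, so it is R or the swapped R'. In
    the second case F R = R' = F R', against injectivity.\<close>
  from F_pair[OF R ab' a'b nk] show False
  proof
    assume *: "(a, b') \<in> F R \<and> (a', b) \<in> F R"
    have "R \<subseteq> F R"
    proof clarify
      fix u v assume uv: "(u, v) \<in> R"
      then have uvX: "u \<in> X" "v \<in> X" using BX_mem[OF R] by auto
      have aux: "(u, v) \<in> F R" if k: "ker R u c" and c: "(c, d) \<in> R" "(c, d) \<in> F R" for c d
      proof -
        have cd: "c \<in> X" "d \<in> X" using BX_mem[OF R c(1)] by auto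
        have "ker (F R) c u" using ker_F[OF R cd(1) uvX(1)] ker_sym[OF k] by simp
        then have "(u, d) \<in> F R" using ker_D[OF T _ c(2)] by blast
        moreover have "ker (R\<inverse>) d v" using ker_D[OF R k uv] c(1) by (auto simp: ker_def)
        then have "ker ((F R)\<inverse>) d v" using coker_F[OF R cd(2) uvX(2)] by blast
        ultimately show ?thesis using coker_D[OF T] by blast
      qed
      show "(u, v) \<in> F R" using blocks[OF uvX(1)] aux ab' a'b * by blast
    qed
    then show False using F_eqI[OF R] nF by blast
  next
    assume *: "(a, b) \<in> F R \<and> (a', b') \<in> F R"
    have "R' \<subseteq> F R"
    proof clarify
      fix u v assume uv: "(u, v) \<in> R'"
      then have uvX: "u \<in> X" "v \<in> X" "(u, v) \<notin> R" by (auto simp: R'_iff)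
      have aux: "(u, v) \<in> F R"
        if k: "ker R u c" and c: "(c, d) \<in> F R" and e: "(e, d) \<in> R" "(e, v) \<in> R" "c \<in> X" for c d e
      proof -
        have "d \<in> X" using BX_mem[OF R e(1)] by auto
        have "ker (F R) c u" using ker_F[OF R e(3) uvX(1)] ker_sym[OF k] by simp
        then have "(u, d) \<in> F R" using ker_D[OF T _ c] by blast
        moreover have "ker (R\<inverse>) d v" using e by (auto simp: ker_def)
        then have "ker ((F R)\<inverse>) d v" using coker_F[OF R \<open>d \<in> X\<close> uvX(2)] by blast
        ultimately show ?thesis using coker_D[OF T] by blast
      qed
      obtain m where m: "(m, v) \<in> R" using BX_ran[OF R uvX(2)] by blast
      then have "m \<in> X" using BX_mem[OF R] by blast
      \<comment> \<open>The point m is matched with v under R and u is not, so m lies in the source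
        block different from that of u.\<close>
      have other: "\<not> (ker R u c \<and> ker R m c)" for c
        using ker_D[OF R ker_trans[OF R _ ker_sym] m, of c u] uvX(3) ker_sym[of R] by blast
      show "(u, v) \<in> F R"
        using blocks[OF uvX(1)]
      proof
        assume k: "ker R u a"
        then have "ker R m a'" using other blocks[OF \<open>m \<in> X\<close>] by blast
        then show ?thesis using aux[OF k, of b a'] * a'b ker_D[OF R _ m] ab(1) by blast
      next
        assume k: "ker R u a'"
        then have "ker R m a" using other blocks[OF \<open>m \<in> X\<close>] by blast
        then show ?thesis using aux[OF k, of b' a] * ab' ker_D[OF R _ m] X'(1) by blast
      qed
    qed
    moreover have "ker R' u s" if u: "u \<in> X" and s: "s \<in> X" and k: "ker (F R) u s" for u s
    proof -
      have k': "ker R s u" using ker_sym[OF k] ker_F[OF R s u] by simp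
      obtain v where v: "(u, v) \<in> R'" using BX_dom[OF R'B u] by blast
      then have "(s, v) \<in> R'" using ker_D[OF R k'] s by (auto simp: R'_iff)
      then show ?thesis using v by (auto simp: ker_def)
    qed
    ultimately have "R' = F R" by (rule BX_eqI_ker[OF R'B T])
    then have "R = R'" using FR' F_inj[OF R R'B] by simp
    then show False using ab' R'_iff by blast
  qed
qed

end


subsection \<open>Automorphisms\<close>

lemma rel_conj_collapse:
  assumes "p \<in> Bij X"
  shows "rel_conj p (collapse X P) = collapse X (p ` P)"
proof -
  have "p ` X = X" using assms by (simp add: Bij_def bij_betw_def)
  moreover have "rel_conj p (Id_on X) = Id_on (p ` X)"
    by (auto simp: rel_conj_iff Id_on_iff)
  moreover have "rel_conj p (P \<times> P) = p ` P \<times> p ` P"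
    by (auto simp: rel_conj_iff) blast
  moreover have "rel_conj p (Id_on X \<union> P \<times> P) = rel_conj p (Id_on X) \<union> rel_conj p (P \<times> P)"
    unfolding rel_conj_def by (rule image_Un)
  ultimately show ?thesis unfolding collapse_def by metis
qed

lemma dual_full:
  assumes three: "x1 \<in> X" "x2 \<in> X" "x3 \<in> X" "x1 \<noteq> x2" "x1 \<noteq> x3" "x2 \<noteq> x3"
    and F: "F \<in> auto (dual_sym_inv_monoid X)"
  shows "\<exists>p\<in>Bij X. \<forall>R\<in>BX X. F R = rel_conj p R"
proof -
  have FB: "F \<in> Bij (BX X)" using F by (simp add: auto_def)
  have hom: "F (bmult X R T) = bmult X (F R) (F T)" if "R \<in> BX X" "T \<in> BX X" for R T
    using F that by (auto simp: auto_def hom_def)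
  have mem: "F R \<in> BX X" if "R \<in> BX X" for R using Bij_mem[OF FB that] .
  have eq: "F R = F T \<longleftrightarrow> R = T" if "R \<in> BX X" "T \<in> BX X" for R T
    using Bij_eq_iff[OF FB that] .
  have F1: "F (Id_on X) = Id_on X"
  proof -
    obtain W where W: "W \<in> BX X" "Id_on X = F W" using Bij_surj[OF FB Id_on_BX] by blast
    have "F (bmult X (Id_on X) W) = bmult X (F (Id_on X)) (Id_on X)"
      using hom[OF Id_on_BX W(1)] W(2) by simp
    then show ?thesis
      using W Id_on_bmult[OF W(1)] bmult_Id_on[OF mem[OF Id_on_BX]] by simp
  qed
  have F1_iff: "F R = Id_on X \<longleftrightarrow> R = Id_on X" if "R \<in> BX X" for R
    using eq[OF that Id_on_BX] F1 by simp
  have atom: "atom X (F e) \<longleftrightarrow> atom X e" if e: "e \<in> BX X" for e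
  proof -
    have surj: "F ` BX X = BX X" using FB by (simp add: Bij_def bij_betw_def)
    have "(\<forall>f\<in>BX X. bmult X f f = f \<and> bmult X f (F e) = F e \<longrightarrow> f = Id_on X \<or> f = F e) \<longleftrightarrow>
        (\<forall>f\<in>BX X. bmult X (F f) (F f) = F f \<and> bmult X (F f) (F e) = F e \<longrightarrow> F f = Id_on X \<or> F f = F e)"
      by (subst (1) surj[symmetric]) blast
    also have "\<dots> \<longleftrightarrow> (\<forall>f\<in>BX X. bmult X f f = f \<and> bmult X f e = e \<longrightarrow> f = Id_on X \<or> f = e)"
      using e by (intro ball_cong) (simp_all add: hom[symmetric] eq F1_iff bmult_closed)
    finally show ?thesis
      unfolding atom_def using e by (simp add: mem hom[symmetric] eq F1_iff bmult_closed)
  qed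
  have cB: "collapse X P \<in> BX X" if "P \<in> pairs X" for P
    by (rule collapse_BX[OF pairs_subset[OF that]])
  have "\<forall>P\<in>pairs X. \<exists>Q\<in>pairs X. F (collapse X P) = collapse X Q"
    using atom[OF cB] by (auto simp: atom_iff)
  then obtain G where G: "\<And>P. P \<in> pairs X \<Longrightarrow> G P \<in> pairs X \<and> F (collapse X P) = collapse X (G P)"
    by metis
  then have Gm: "G P \<in> pairs X" and Gc: "F (collapse X P) = collapse X (G P)"
    if "P \<in> pairs X" for P using that by auto
  have Geq: "G P = G Q \<longleftrightarrow> P = Q" if "P \<in> pairs X" "Q \<in> pairs X" for P Q
    using eq[OF cB[OF that(1)] cB[OF that(2)]] collapse_inj that Gm Gc by metis
  have bij: "bij_betw G (pairs X) (pairs X)"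
    unfolding bij_betw_def
  proof
    show "inj_on G (pairs X)" using Geq by (auto simp: inj_on_def)
    show "G ` pairs X = pairs X"
    proof
      show "pairs X \<subseteq> G ` pairs X"
      proof
        fix Q assume Q: "Q \<in> pairs X"
        obtain e where e: "e \<in> BX X" "collapse X Q = F e" using Bij_surj[OF FB cB[OF Q]] by blast
        have "atom X (collapse X Q)" using Q by (auto simp: atom_iff)
        then have "atom X e" using atom[OF e(1)] e(2) by simp
        then obtain P where P: "P \<in> pairs X" "e = collapse X P" by (auto simp: atom_iff)
        then have "Q = G P" using e(2) Gc collapse_inj[OF Q Gm] by simp
        then show "Q \<in> G ` pairs X" using P(1) by blast
      qed
    qed (use Gm in blast)
  qed
  have "\<exists>p\<in>Bij X. \<forall>P\<in>pairs X. G P = p ` P"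
  proof (rule permutation_of_pairs[OF three bij])
    fix P Q T assume PQT: "P \<in> pairs X" "Q \<in> pairs X" "T \<in> pairs X" and ne: "P \<noteq> Q" "P \<noteq> T" "Q \<noteq> T"
    let ?e = "bmult X (collapse X P) (collapse X Q)"
    have eB: "?e \<in> BX X" using PQT by (intro bmult_closed cB)
    have "P \<inter> Q \<noteq> {} \<and> T \<subseteq> P \<union> Q \<longleftrightarrow> F (bmult X (collapse X T) ?e) = F ?e"
      using triangle_iff[OF PQT ne] eq[OF bmult_closed[OF cB[OF PQT(3)] eB] eB] by simp
    also have "\<dots> \<longleftrightarrow> G P \<inter> G Q \<noteq> {} \<and> G T \<subseteq> G P \<union> G Q"
      using triangle_iff[OF Gm Gm Gm, of P Q T] PQT ne
      by (simp add: hom cB eB Gc Geq)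
    finally show "P \<inter> Q \<noteq> {} \<and> T \<subseteq> P \<union> Q \<longleftrightarrow> G P \<inter> G Q \<noteq> {} \<and> G T \<subseteq> G P \<union> G Q" .
  qed
  then obtain p where p: "p \<in> Bij X" "\<And>P. P \<in> pairs X \<Longrightarrow> G P = p ` P" by blast
  obtain q where q: "q \<in> Bij X" "compose X p q = (\<lambda>x\<in>X. x)" "compose X q p = (\<lambda>x\<in>X. x)"
    using Bij_inverse[OF p(1)] by metis
  have pq: "rel_conj p (rel_conj q U) = U" if "U \<in> BX X" for U
    using rel_conj_compose[OF that, of p q] q rel_conj_id[OF that] by simp
  have qp: "q (p x) = x" if "x \<in> X" for x using fun_cong[OF q(3), of x] that by (simp add: compose_eq)
  interpret atom_fixing X "\<lambda>R. rel_conj q (F R)"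
  proof
    fix R T assume RT: "R \<in> BX X" "T \<in> BX X"
    show "rel_conj q (F R) \<in> BX X" using RT by (intro rel_conj_BX q mem)
    show "rel_conj q (F (bmult X R T)) = bmult X (rel_conj q (F R)) (rel_conj q (F T))"
      using RT by (simp add: hom rel_conj_bmult q mem)
    show "R = T" if "rel_conj q (F R) = rel_conj q (F T)"
      using that pq[OF mem] RT eq by metis
  next
    fix x z assume xz: "x \<in> X" "z \<in> X"
    show "rel_conj q (F (collapse X {x, z})) = collapse X {x, z}"
    proof -
      have "F (collapse X {x, z}) = collapse X (p ` {x, z})"
      \<comment> \<open>For x = z the collapse is the identity and not an atom, so \<open>G\<close>
        says nothing about it.\<close>
      proof (cases "x = z")
        case True
        then have "collapse X {x, z} = Id_on X" "collapse X (p ` {x, z}) = Id_on X"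
          using xz Bij_mem[OF p(1)] by (auto simp: collapse_def)
        then show ?thesis using F1 by simp
      next
        case False
        then have P: "{x, z} \<in> pairs X" by (rule pair_in_pairs[OF xz])
        show ?thesis unfolding Gc[OF P] p(2)[OF P] ..
      qed
      then have "rel_conj q (F (collapse X {x, z})) = collapse X (q ` p ` {x, z})"
        by (simp only: rel_conj_collapse[OF q(1)])
      also have "q ` p ` {x, z} = {x, z}" using qp xz by simp
      finally show ?thesis .
    qed
  qed
  have "F R = rel_conj p R" if "R \<in> BX X" for R
    using F_fixes_all[OF three that] pq[OF mem[OF that]] by simp
  then show ?thesis using p(1) by blast
qed

text \<open>The atoms show only that p and q agree on pairs; a point is recovered as the common
  element of two pairs through it, which takes three points.\<close>

lemma rel_conj_faithful:
  assumes three: "x1 \<in> X" "x2 \<in> X" "x3 \<in> X" "x1 \<noteq> x2" "x1 \<noteq> x3" "x2 \<noteq> x3"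
    and p: "p \<in> Bij X" and q: "q \<in> Bij X"
    and eq: "\<And>R. R \<in> BX X \<Longrightarrow> rel_conj p R = rel_conj q R"
  shows "p = q"
proof (rule Bij_ext[OF p q])
  fix x assume x: "x \<in> X"
  have pair: "{p x, p y} = {q x, q y}" if y: "y \<in> X" "x \<noteq> y" for y
  proof -
    have P: "{x, y} \<subseteq> X" using x y by simp
    have pairs: "{p x, p y} \<in> pairs X" "{q x, q y} \<in> pairs X"
      using x y p q by (auto intro!: pair_in_pairs simp: Bij_mem Bij_eq_iff)
    have "collapse X {p x, p y} = collapse X {q x, q y}"
      using eq[OF collapse_BX[OF P]] by (simp add: rel_conj_collapse p q)
    then show ?thesis using collapse_inj[OF pairs] by simp
  qed
  obtain y z where yz: "y \<in> X" "z \<in> X" "x \<noteq> y" "x \<noteq> z" "y \<noteq> z"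
    using three by (cases "x = x1"; cases "x = x2") blast+
  then have "p y \<noteq> p z" "p x \<noteq> p y" "p x \<noteq> p z" using x Bij_eq_iff[OF p] by auto
  then show "p x = q x" using pair[of y] pair[of z] yz by (auto simp: doubleton_eq_iff)
qed

lemma dual_noncomm:
  assumes three: "x1 \<in> X" "x2 \<in> X" "x3 \<in> X" "x1 \<noteq> x2" "x1 \<noteq> x3" "x2 \<noteq> x3"
  shows "\<exists>R\<in>BX X. \<exists>T\<in>BX X. bmult X R T \<noteq> bmult X T R"
proof -
  \<comment> \<open>R matches {x1} with {x2} and complement with complement. The points x2 and x3
    share a source block, so T is absorbed on the left, but they lie in different target blocks,
    which T merges on the right.\<close>
  let ?R = "{(u, v). u \<in> X \<and> v \<in> X \<and> (u = x1 \<longleftrightarrow> v = x2)}"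
  let ?T = "collapse X {x2, x3}"
  have R: "?R \<in> BX X"
    by (rule BX_I) (use three in auto)
  have T: "?T \<in> BX X" using three by (intro collapse_BX) auto
  have TR: "bmult X ?T ?R = ?R"
    using three by (subst ker_iff_bmult[OF R]) (auto simp: ker_def)
  have "(x1, x3) \<in> bmult X ?R ?T"
    by (rule bmult_I[OF R T, of _ x2]) (use three in \<open>auto simp: collapse_iff\<close>)
  moreover have "(x1, x3) \<notin> bmult X ?T ?R" unfolding TR using three by auto
  ultimately have "bmult X ?R ?T \<noteq> bmult X ?T ?R" by fast
  then show ?thesis by (rule bexI[OF bexI[OF _ T] R])
qed

lemma sym_semigroup_dual:
  assumes three: "x1 \<in> X" "x2 \<in> X" "x3 \<in> X" "x1 \<noteq> x2" "x1 \<noteq> x3" "x2 \<noteq> x3"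
  shows "sym_semigroup (dual_sym_inv_monoid X) X rel_conj converse"
proof
  fix p q :: "'a \<Rightarrow> 'a" and R :: "('a \<times> 'a) set"
  show "\<exists>p\<in>Bij X. \<forall>s\<in>carrier (dual_sym_inv_monoid X). F s = rel_conj p s"
    if "F \<in> auto (dual_sym_inv_monoid X)" for F
    using dual_full[OF three that] by simp
  show "p = q" if "p \<in> Bij X" "q \<in> Bij X"
    "\<And>s. s \<in> carrier (dual_sym_inv_monoid X) \<Longrightarrow> rel_conj p s = rel_conj q s"
    using rel_conj_faithful[OF three that(1,2)] that(3) by simp
  show "rel_conj p (R\<inverse>) = (rel_conj p R)\<inverse>"
    by (auto simp: rel_conj_def)
qed (simp_all add: bmult_closed rel_conj_BX rel_conj_bmult rel_conj_id rel_conj_compose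
    converse_BX converse_bmult)

text \<open>Since \<open>card\<close> is 0 on infinite sets, the implication in the premise
  expresses |X| >= 3 for arbitrary X.\<close>

lemma three_points:
  assumes "finite X \<longrightarrow> 3 \<le> card X"
  shows "\<exists>x\<in>X. \<exists>y\<in>X. \<exists>z\<in>X. x \<noteq> y \<and> x \<noteq> z \<and> y \<noteq> z"
proof -
  obtain Y where "Y \<subseteq> X" "card Y = 3"
    using assms by (metis infinite_arbitrarily_large obtain_subset_with_card_n)
  then show ?thesis by (auto simp: card_3_iff)
qed

text \<open>On at most one point inversion in \<I>_X is the identity map and there is no factor of
  order two; hence the premise of two distinct points on that one isomorphism.\<close>

theorem mainTheorem8:
  fixes X :: "'a set"
  shows
    "(AutoGroup (sym_inv_monoid X) \<cong> BijGroup X \<and>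
      involution_span (sym_inv_monoid X) = carrier (AutPMGroup (sym_inv_monoid X)) \<and>
      ((\<exists>x\<in>X. \<exists>y\<in>X. x \<noteq> y) \<longrightarrow>
        AutPMGroup (sym_inv_monoid X) \<cong> integer_mod_group 2 \<times>\<times> BijGroup X)) \<and>
     ((finite X \<longrightarrow> 3 \<le> card X) \<longrightarrow>
      AutoGroup (dual_sym_inv_monoid X) \<cong> BijGroup X \<and>
      involution_span (dual_sym_inv_monoid X) = carrier (AutPMGroup (dual_sym_inv_monoid X)) \<and>
      AutPMGroup (dual_sym_inv_monoid X) \<cong> integer_mod_group 2 \<times>\<times> BijGroup X)"
proof (intro conjI impI)
  show "AutoGroup (sym_inv_monoid X) \<cong> BijGroup X" by (rule sym_inv.AutoGroup_iso)
  show "involution_span (sym_inv_monoid X) = carrier (AutPMGroup (sym_inv_monoid X))"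
    by (rule sym_inv_span)
  show "AutPMGroup (sym_inv_monoid X) \<cong> integer_mod_group 2 \<times>\<times> BijGroup X"
    if "\<exists>x\<in>X. \<exists>y\<in>X. x \<noteq> y"
    using that sym_inv_noncomm sym_inv.AutPMGroup_iso by metis
next
  assume "finite X \<longrightarrow> 3 \<le> card X"
  then obtain x1 x2 x3 where three:
    "x1 \<in> X" "x2 \<in> X" "x3 \<in> X" "x1 \<noteq> x2" "x1 \<noteq> x3" "x2 \<noteq> x3"
    using three_points by metis
  interpret dual: sym_semigroup "dual_sym_inv_monoid X" X rel_conj converse
    by (rule sym_semigroup_dual[OF three])
  obtain R T where RT: "R \<in> BX X" "T \<in> BX X" "bmult X R T \<noteq> bmult X T R"
    using dual_noncomm[OF three] by blast
  show "AutoGroup (dual_sym_inv_monoid X) \<cong> BijGroup X" by (rule dual.AutoGroup_iso)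
  show "involution_span (dual_sym_inv_monoid X) = carrier (AutPMGroup (dual_sym_inv_monoid X))"
    using RT by (intro dual.involution_span_eq) simp_all
  show "AutPMGroup (dual_sym_inv_monoid X) \<cong> integer_mod_group 2 \<times>\<times> BijGroup X"
    using RT by (intro dual.AutPMGroup_iso) simp_all
qed

end
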